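(* Let $(W,S)$ be a Coxeter system and let $I,J,K,L\subset S$ be finitary. Suppose that $q$ and $q'$ are $(I,J)$-cosets with $q'<q$, and let $p$ be a $(K,I)$-coset and $r$ a $(J,L)$-coset. If $p.q.r$ is a reduced composition, then $$p*q'*r<p.q.r .$$
   Context: $(W,S)$ is a Coxeter system with length function $\ell$. For $I\subset S$, $W_I$ is the subgroup generated by $I$; $I$ is finitary if $W_I$ is finite, and then $w_I$ is its longest element. The $*$-product on $W$ is the associative monoid product determined by $s*w=sw$ if $sw>w$ and $s*w=w$ if $sw<w$ ($s\in S$, $w\in W$), with unit the identity. An $(I,J)$-coset is an element $p\in W_I\backslash W/W_J$ (regarded as a triple $(p,I,J)$). $\overline{p}$ and $\underline{p}$ denote the maximal and minimal elements of the set $p$ in the Bruhat order. For $(I,J)$-cosets, $p\le q$ means $\underline p\le\underline q$, and $p<q$ means $p\le q$ and $p\ne q$. If $p$ is an $(I,J)$-coset and $q$ is a $(J,K)$-coset, $p*q$ is the unique $(I,K)$-coset with $\overline{p*q}=\overline p*\overline q$. A (singlestep) expression is a sequence $I_\bullet=[I_0,I_1,\dots,I_d]$ of finitary subsets of $S$ such that each $I_k$ is obtained from $I_{k-1}$ by adding or removing one element of $S$. It expresses the unique $(I_0,I_d)$-coset $q$ with $\overline{q}=w_{I_0}*w_{I_1}*\cdots*w_{I_d}$. Expressions $[P_0,\dots,P_c]$ and $[Q_0,\dots,Q_d]$ with $P_c=Q_0$ are concatenated to $P_\bullet\circ Q_\bullet=[P_0,\dots,P_c=Q_0,\dots,Q_d]$.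 Reduced expressions: recording the local maxima and minima of $I_\bullet$ gives a multistep expression $I_0=L_0\subset K_1\supset L_1\subset K_2\supset\cdots\subset K_m\supset L_m=I_d$ (with $L_0=K_1$ if $I_\bullet$ starts by decreasing and $K_m=L_m$ if it ends by increasing). $I_\bullet$, expressing $q$, is reduced if $\overline{q}=(w_{K_1}w_{L_1}^{-1})(w_{K_2}w_{L_2}^{-1})\cdots(w_{K_{m-1}}w_{L_{m-1}}^{-1})\,w_{K_m}$ and the length of $\overline q$ is the sum of the lengths of these factors. Reduced composition: for an $(I,J)$-coset $p$, a $(J,K)$-coset $q$ and an $(I,K)$-coset $r$ one writes $p.q=r$, and calls $r$ a reduced composition of $p$ and $q$, if there are reduced expressions $P_\bullet$ of $p$ and $Q_\bullet$ of $q$ such that $P_\bullet\circ Q_\bullet$ is a reduced expression of $r$ (then $r=p*q$). Likewise, $p.q.r$ is a reduced composition if there are reduced expressions $P_\bullet,Q_\bullet,R_\bullet$ of $p,q,r$ such that $P_\bullet\circ Q_\bullet\circ R_\bullet$ is reduced; then $p.q.r$ denotes the coset $p*q*r$ it expresses. *)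

theory Defs
  imports "HOL-Algebra.Generated_Groups" "HOL-Algebra.Multiplicative_Group"
begin

definition word_prod :: "('a, 'b) monoid_scheme \<Rightarrow> 'a list \<Rightarrow> 'a" where
  "word_prod G xs = foldr (\<otimes>\<^bsub>G\<^esub>) xs \<one>\<^bsub>G\<^esub>"

text \<open>Insertion of a relator \<open>(st)\<^sup>m\<close> into a word, where \<open>m\<close> is the order of \<open>st\<close>. If \<open>st\<close> has
  infinite order, then \<open>group.ord\<close> is 0 and there is no relation; for \<open>s = t\<close> an involution
  the relator is \<open>ss\<close>.\<close>

definition relator_insertions :: "('a, 'b) monoid_scheme \<Rightarrow> 'a set \<Rightarrow> ('a list \<times> 'a list) set" where
  "relator_insertions G S =
     {(u @ v, u @ concat (replicate (group.ord G (s \<otimes>\<^bsub>G\<^esub> t)) [s, t]) @ v) | u v s t.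
        u \<in> lists S \<and> v \<in> lists S \<and> s \<in> S \<and> t \<in> S}"

text \<open>\<open>G\<close> is presented by the generators \<open>S\<close> and the relations \<open>(st)\<^sup>m\<^sup>(\<^sup>s\<^sup>,\<^sup>t\<^sup>) = 1\<close>: two words have the
  same value in \<open>G\<close> only if insertions and deletions of relators transform one into the other.
  Positive words suffice because \<open>ss\<close> is a relator for every \<open>s \<in> S\<close>.
  The set \<open>S\<close> may be infinite.\<close>

definition coxeter_system :: "('a, 'b) monoid_scheme \<Rightarrow> 'a set \<Rightarrow> bool" where
  "coxeter_system G S \<longleftrightarrow>
     group G \<and> S \<subseteq> carrier G \<and> generate G S = carrier G \<and>
     (\<forall>s\<in>S. s \<noteq> \<one>\<^bsub>G\<^esub> \<and> s \<otimes>\<^bsub>G\<^esub> s = \<one>\<^bsub>G\<^esub>) \<and>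
     (\<forall>u\<in>lists S. \<forall>v\<in>lists S. word_prod G u = word_prod G v \<longrightarrow>
        (u, v) \<in> (relator_insertions G S \<union> (relator_insertions G S)\<inverse>)\<^sup>*)"

definition cox_length :: "('a, 'b) monoid_scheme \<Rightarrow> 'a set \<Rightarrow> 'a \<Rightarrow> nat" where
  "cox_length G S w = (LEAST n. \<exists>xs\<in>lists S. length xs = n \<and> word_prod G xs = w)"

definition reflections :: "('a, 'b) monoid_scheme \<Rightarrow> 'a set \<Rightarrow> 'a set" where
  "reflections G S = {w \<otimes>\<^bsub>G\<^esub> s \<otimes>\<^bsub>G\<^esub> inv\<^bsub>G\<^esub> w | w s. w \<in> carrier G \<and> s \<in> S}"

definition bruhat_le :: "('a, 'b) monoid_scheme \<Rightarrow> 'a set \<Rightarrow> 'a \<Rightarrow> 'a \<Rightarrow> bool" where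
  "bruhat_le G S u w \<longleftrightarrow>
     (u, w) \<in> {(x, x \<otimes>\<^bsub>G\<^esub> t) | x t. x \<in> carrier G \<and> t \<in> reflections G S \<and>
                  cox_length G S x < cox_length G S (x \<otimes>\<^bsub>G\<^esub> t)}\<^sup>*"

definition bruhat_less :: "('a, 'b) monoid_scheme \<Rightarrow> 'a set \<Rightarrow> 'a \<Rightarrow> 'a \<Rightarrow> bool" where
  "bruhat_less G S u w \<longleftrightarrow> bruhat_le G S u w \<and> u \<noteq> w"

text \<open>The associative product \<open>*\<close> on \<open>carrier G\<close>. The conditions determine it there;
  its values outside \<open>carrier G\<close> are irrelevant.\<close>

definition is_star_product ::
  "('a, 'b) monoid_scheme \<Rightarrow> 'a set \<Rightarrow> ('a \<Rightarrow> 'a \<Rightarrow> 'a) \<Rightarrow> bool" where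
  "is_star_product G S m \<longleftrightarrow>
     monoid (G\<lparr>mult := m\<rparr>) \<and>
     (\<forall>s\<in>S. \<forall>w\<in>carrier G.
        (bruhat_less G S w (s \<otimes>\<^bsub>G\<^esub> w) \<longrightarrow> m s w = s \<otimes>\<^bsub>G\<^esub> w) \<and>
        (bruhat_less G S (s \<otimes>\<^bsub>G\<^esub> w) w \<longrightarrow> m s w = w))"

definition star :: "('a, 'b) monoid_scheme \<Rightarrow> 'a set \<Rightarrow> 'a \<Rightarrow> 'a \<Rightarrow> 'a" where
  "star G S = (SOME m. is_star_product G S m)"

definition finitary :: "('a, 'b) monoid_scheme \<Rightarrow> 'a set \<Rightarrow> 'a set \<Rightarrow> bool" where
  "finitary G S I \<longleftrightarrow> I \<subseteq> S \<and> finite (generate G I)"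

definition longest :: "('a, 'b) monoid_scheme \<Rightarrow> 'a set \<Rightarrow> 'a set \<Rightarrow> 'a" where
  "longest G S I = (THE w. w \<in> generate G I \<and>
     (\<forall>v\<in>generate G I. cox_length G S v \<le> cox_length G S w))"

text \<open>An \<open>(I, J)\<close>-coset is the triple \<open>(X, I, J)\<close>, with \<open>X\<close> the underlying subset of the group.\<close>

type_synonym 'a dcoset = "'a set \<times> 'a set \<times> 'a set"

definition dcosets :: "('a, 'b) monoid_scheme \<Rightarrow> 'a set \<Rightarrow> 'a set \<Rightarrow> 'a dcoset set" where
  "dcosets G I J =
     {((generate G I #>\<^bsub>G\<^esub> w) <#>\<^bsub>G\<^esub> generate G J, I, J) | w. w \<in> carrier G}"

definition max_elt :: "('a, 'b) monoid_scheme \<Rightarrow> 'a set \<Rightarrow> 'a dcoset \<Rightarrow> 'a" where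
  "max_elt G S p = (THE x. x \<in> fst p \<and> (\<forall>y\<in>fst p. bruhat_le G S y x))"

definition min_elt :: "('a, 'b) monoid_scheme \<Rightarrow> 'a set \<Rightarrow> 'a dcoset \<Rightarrow> 'a" where
  "min_elt G S p = (THE x. x \<in> fst p \<and> (\<forall>y\<in>fst p. bruhat_le G S x y))"

definition dcoset_le :: "('a, 'b) monoid_scheme \<Rightarrow> 'a set \<Rightarrow> 'a dcoset \<Rightarrow> 'a dcoset \<Rightarrow> bool" where
  "dcoset_le G S p q \<longleftrightarrow> bruhat_le G S (min_elt G S p) (min_elt G S q)"

definition dcoset_less :: "('a, 'b) monoid_scheme \<Rightarrow> 'a set \<Rightarrow> 'a dcoset \<Rightarrow> 'a dcoset \<Rightarrow> bool" where
  "dcoset_less G S p q \<longleftrightarrow> dcoset_le G S p q \<and> p \<noteq> q"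

text \<open>Only meaningful for an \<open>(I, J)\<close>-coset \<open>p\<close> and a \<open>(J, K)\<close>-coset \<open>q\<close>.\<close>

definition dcoset_star ::
  "('a, 'b) monoid_scheme \<Rightarrow> 'a set \<Rightarrow> 'a dcoset \<Rightarrow> 'a dcoset \<Rightarrow> 'a dcoset" where
  "dcoset_star G S p q =
     (THE x. x \<in> dcosets G (fst (snd p)) (snd (snd q)) \<and>
        max_elt G S x = star G S (max_elt G S p) (max_elt G S q))"

definition is_expression :: "('a, 'b) monoid_scheme \<Rightarrow> 'a set \<Rightarrow> 'a set list \<Rightarrow> bool" where
  "is_expression G S Is \<longleftrightarrow>
     Is \<noteq> [] \<and> (\<forall>A\<in>set Is. finitary G S A) \<and>
     successively (\<lambda>A B. \<exists>s\<in>S. (s \<notin> A \<and> B = insert s A) \<or> (s \<in> A \<and> B = A - {s})) Is"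

definition expresses ::
  "('a, 'b) monoid_scheme \<Rightarrow> 'a set \<Rightarrow> 'a set list \<Rightarrow> 'a dcoset \<Rightarrow> bool" where
  "expresses G S Is q \<longleftrightarrow>
     is_expression G S Is \<and> q \<in> dcosets G (hd Is) (last Is) \<and>
     max_elt G S q = foldr (star G S) (map (longest G S) Is) \<one>\<^bsub>G\<^esub>"

text \<open>The local maxima \<open>K\<^sub>1, \<dots>, K\<^sub>m\<close>. An endpoint is included if its only neighbour is smaller,
  and a one-term expression has \<open>K\<^sub>1 = I\<^sub>0\<close>.\<close>

definition local_maxima :: "'a set list \<Rightarrow> 'a set list" where
  "local_maxima Is = [Is ! k. k \<leftarrow> [0..<length Is],
     (k = 0 \<or> Is ! (k - 1) \<subset> Is ! k) \<and> (Suc k = length Is \<or> Is ! Suc k \<subset> Is ! k)]"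

text \<open>The interior local minima \<open>L\<^sub>1, \<dots>, L\<^sub>m\<^sub>-\<^sub>1\<close>; the endpoints \<open>L\<^sub>0\<close> and \<open>L\<^sub>m\<close> do not enter the
  factorization.\<close>

definition local_minima :: "'a set list \<Rightarrow> 'a set list" where
  "local_minima Is = [Is ! k. k \<leftarrow> [1..<length Is - 1],
     Is ! k \<subset> Is ! (k - 1) \<and> Is ! k \<subset> Is ! Suc k]"

text \<open>\<open>[w\<^bsub>K\<^sub>1\<^esub> w\<^bsub>L\<^sub>1\<^esub>\<^sup>-\<^sup>1, \<dots>, w\<^bsub>K\<^sub>m\<^sub>-\<^sub>1\<^esub> w\<^bsub>L\<^sub>m\<^sub>-\<^sub>1\<^esub>\<^sup>-\<^sup>1, w\<^bsub>K\<^sub>m\<^esub>]\<close>; there is one maximum more than there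
  are interior minima, and \<open>zip\<close> drops the last one.\<close>

definition factors :: "('a, 'b) monoid_scheme \<Rightarrow> 'a set \<Rightarrow> 'a set list \<Rightarrow> 'a list" where
  "factors G S Is =
     map (\<lambda>(K, L). longest G S K \<otimes>\<^bsub>G\<^esub> inv\<^bsub>G\<^esub> (longest G S L)) (zip (local_maxima Is) (local_minima Is))
     @ [longest G S (last (local_maxima Is))]"

definition reduced_expression ::
  "('a, 'b) monoid_scheme \<Rightarrow> 'a set \<Rightarrow> 'a set list \<Rightarrow> 'a dcoset \<Rightarrow> bool" where
  "reduced_expression G S Is q \<longleftrightarrow>
     expresses G S Is q \<and>
     max_elt G S q = word_prod G (factors G S Is) \<and>
     cox_length G S (max_elt G S q) = sum_list (map (cox_length G S) (factors G S Is))"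

text \<open>\<open>P \<circ> Q\<close>, for \<open>last P = hd Q\<close>.\<close>

definition expr_concat :: "'a set list \<Rightarrow> 'a set list \<Rightarrow> 'a set list" where
  "expr_concat P Q = P @ tl Q"

text \<open>\<open>p.q.r = x\<close> is a reduced composition.\<close>

definition reduced_composition3 ::
  "('a, 'b) monoid_scheme \<Rightarrow> 'a set \<Rightarrow> 'a dcoset \<Rightarrow> 'a dcoset \<Rightarrow> 'a dcoset \<Rightarrow> 'a dcoset \<Rightarrow> bool" where
  "reduced_composition3 G S p q r x \<longleftrightarrow>
     (\<exists>P Q R. reduced_expression G S P p \<and> reduced_expression G S Q q \<and> reduced_expression G S R r \<and>
        last P = hd Q \<and> last Q = hd R \<and>
        reduced_expression G S (expr_concat (expr_concat P Q) R) x)"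

end

theory Submission
  imports Defs
begin

text \<open>Write \<open>w\<^sub>I\<close> for the longest element of \<open>W\<^sub>I\<close>. The maximal elements factor as
  \<open>max p = a w\<^sub>I\<close> and \<open>max r = w\<^sub>J b\<close> with additive lengths, and \<open>w\<^sub>I\<close>, \<open>w\<^sub>J\<close> are absorbed by
  \<open>max q'\<close> in the star product. Hence \<open>max (p * q' * r) = a * max q' * b\<close> has length at most
  \<open>\<ell>(a) + \<ell>(max q') + \<ell>(b) < \<ell>(a) + \<ell>(max q) + \<ell>(b)\<close>. A reduced expression has length
  \<open>\<Sum> \<ell>(w\<^sub>K) - \<Sum> \<ell>(w\<^sub>L)\<close> over its local maxima \<open>K\<close> and interior local minima \<open>L\<close>, which is
  additive under concatenation at \<open>I\<close> up to subtracting \<open>\<ell>(w\<^sub>I)\<close>, so the right hand side is the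
  length of \<open>max (p.q.r)\<close>. The weak inequality is monotonicity of the star product in the Bruhat
  order, since \<open>p \<le> q\<close> is equivalent to \<open>max p \<le> max q\<close>.

  The exchange property is extracted from the presentation: the parity with which a
  reflection occurs in the reflection sequence of a word is invariant under insertion of
  relators.\<close>

section \<open>Words in the generators and the length function\<close>

lemma word_prod_Nil [simp]: "word_prod G [] = \<one>\<^bsub>G\<^esub>"
  by (simp add: word_prod_def)

lemma word_prod_Cons [simp]: "word_prod G (x # xs) = x \<otimes>\<^bsub>G\<^esub> word_prod G xs"
  by (simp add: word_prod_def)

locale coxeter = group G for G (structure) +
  fixes S
  assumes coxeter_system: "coxeter_system G S"
begin

abbreviation "len \<equiv> cox_length G S"
abbreviation "word \<equiv> word_prod G"
abbreviation "refls \<equiv> reflections G S"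
abbreviation bruhat (infix "\<preceq>" 50) where "x \<preceq> y \<equiv> bruhat_le G S x y"

lemma S_carrier: "S \<subseteq> carrier G"
  using coxeter_system by (simp add: coxeter_system_def)

lemma S_closed [simp, intro]: "s \<in> S \<Longrightarrow> s \<in> carrier G"
  using S_carrier by blast

lemma S_square [simp]: "s \<in> S \<Longrightarrow> s \<otimes> s = \<one>"
  using coxeter_system by (simp add: coxeter_system_def)

lemma S_inv [simp]: "s \<in> S \<Longrightarrow> inv s = s"
  by (simp add: inv_equality)

lemma S_cancel [simp]: "s \<in> S \<Longrightarrow> x \<in> carrier G \<Longrightarrow> s \<otimes> (s \<otimes> x) = x"
  by (simp flip: m_assoc)

lemma S_cancel_right [simp]: "s \<in> S \<Longrightarrow> x \<in> carrier G \<Longrightarrow> x \<otimes> s \<otimes> s = x"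
  by (simp add: m_assoc)

lemma inv_cancel [simp]:
  assumes "x \<in> carrier G" "y \<in> carrier G"
  shows "inv x \<otimes> (x \<otimes> y) = y" "x \<otimes> (inv x \<otimes> y) = y"
  using assms by (simp_all flip: m_assoc)

text \<open>Keeps a hypothesis \<open>xs \<in> lists S\<close> whole during automation, in the form
  in which the lemmas on \<open>word\<close> expect it.\<close>

declare in_listsD [rule del] in_listsI [rule del]

lemma word_closed [simp, intro]: "xs \<in> lists S \<Longrightarrow> word xs \<in> carrier G"
  by (induction xs) auto

lemma word_append: "xs \<in> lists S \<Longrightarrow> ys \<in> lists S \<Longrightarrow> word (xs @ ys) = word xs \<otimes> word ys"
  by (induction xs) (auto simp: m_assoc)

lemma rev_in_lists [simp]: "rev xs \<in> lists A \<longleftrightarrow> xs \<in> lists A"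
  by (simp add: in_lists_conv_set)

lemma word_rev: "xs \<in> lists S \<Longrightarrow> word (rev xs) = inv (word xs)"
  by (induction xs) (auto simp: word_append inv_mult_group)

text \<open>Generators are involutions, so words need no inverse letters.\<close>

lemma generate_eq_words:
  assumes "A \<subseteq> S" shows "generate G A = word ` lists A"
proof -
  have *: "lists A \<subseteq> lists S" using assms by (rule lists_mono)
  have "x \<in> word ` lists A" if "x \<in> generate G A" for x
    using that
  proof (induction rule: generate.induct)
    case one
    then show ?case by (intro image_eqI[of _ _ "[]"]) auto
  next
    case (incl h)
    then show ?case using assms by (intro image_eqI[of _ _ "[h]"]) auto
  next
    case (inv h)
    then show ?case using assms by (intro image_eqI[of _ _ "[h]"]) auto
  next
    case (eng h1 h2)
    then obtain xs ys where "xs \<in> lists A" "ys \<in> lists A" "h1 = word xs" "h2 = word ys" by auto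
    moreover from this have "xs \<in> lists S" "ys \<in> lists S" using * by blast+
    ultimately show ?case by (intro image_eqI[of _ _ "xs @ ys"]) (simp_all add: word_append)
  qed
  moreover have "word xs \<in> generate G A" if "xs \<in> lists A" for xs
    using that by (induction xs) (auto intro: generate.intros)
  ultimately show ?thesis by blast
qed

lemma carrier_eq_words: "carrier G = word ` lists S"
  using generate_eq_words[of S] coxeter_system by (simp add: coxeter_system_def)

lemma len_word_le: "xs \<in> lists S \<Longrightarrow> len (word xs) \<le> length xs"
  unfolding cox_length_def by (rule Least_le) auto

lemma reduced_word:
  assumes "x \<in> carrier G"
  obtains xs where "xs \<in> lists S" "word xs = x" "length xs = len x"
proof -
  have "\<exists>n. \<exists>xs\<in>lists S. length xs = n \<and> word xs = x"
    using assms carrier_eq_words by auto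
  from LeastI_ex[OF this] show ?thesis
    using that unfolding cox_length_def by auto
qed

lemma len_mult_le:
  assumes "x \<in> carrier G" "y \<in> carrier G" shows "len (x \<otimes> y) \<le> len x + len y"
proof -
  obtain xs where xs: "xs \<in> lists S" "word xs = x" "length xs = len x"
    using reduced_word assms by blast
  obtain ys where ys: "ys \<in> lists S" "word ys = y" "length ys = len y"
    using reduced_word assms by blast
  show ?thesis using len_word_le[of "xs @ ys"] xs ys by (simp add: word_append)
qed

lemma len_inv [simp]: assumes "x \<in> carrier G" shows "len (inv x) = len x"
proof -
  have *: "len (inv x) \<le> len x" if x: "x \<in> carrier G" for x
  proof -
    obtain xs where "xs \<in> lists S" "word xs = x" "length xs = len x"
      using reduced_word x by blast
    then show ?thesis using len_word_le[of "rev xs"] by (simp add: word_rev)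
  qed
  show ?thesis using *[OF assms] *[of "inv x"] assms by simp
qed

lemma len_one [simp]: "len \<one> = 0"
  using len_word_le[of "[]"] by simp

lemma len_generator_le: "s \<in> S \<Longrightarrow> len s \<le> 1"
  using len_word_le[of "[s]"] by simp

section \<open>Reflections: closure under conjugation, and the involution property\<close>

lemma reflectionE:
  assumes "t \<in> refls"
  obtains w s where "w \<in> carrier G" "s \<in> S" "t = w \<otimes> s \<otimes> inv w"
  using assms unfolding reflections_def by blast

lemma reflection_closed [simp]: "t \<in> refls \<Longrightarrow> t \<in> carrier G"
  by (auto elim!: reflectionE)

lemma generator_reflection: "s \<in> S \<Longrightarrow> s \<in> refls"
  unfolding reflections_def by (intro CollectI exI[of _ \<one>] exI[of _ s]) auto

lemma conj_reflection:
  assumes "t \<in> refls" "x \<in> carrier G" shows "x \<otimes> t \<otimes> inv x \<in> refls"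
proof -
  obtain w s where *: "w \<in> carrier G" "s \<in> S" "t = w \<otimes> s \<otimes> inv w"
    using assms(1) by (rule reflectionE)
  show ?thesis unfolding reflections_def
    by (intro CollectI exI[of _ "x \<otimes> w"] exI[of _ s])
      (use * assms(2) in \<open>simp add: m_assoc inv_mult_group\<close>)
qed

lemma reflection_square: assumes "t \<in> refls" shows "t \<otimes> t = \<one>"
proof -
  obtain w s where *: "w \<in> carrier G" "s \<in> S" "t = w \<otimes> s \<otimes> inv w"
    using assms(1) by (rule reflectionE)
  then show ?thesis by (simp add: m_assoc)
qed

lemma reflection_inv: "t \<in> refls \<Longrightarrow> inv t = t"
  by (simp add: inv_equality reflection_square)

subsection \<open>The strong exchange property\<close>

text \<open>The parity of the number of occurrences of \<open>t\<close> among the reflections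
  \<open>(s\<^sub>i\<^sub>+\<^sub>1 \<cdots> s\<^sub>k)\<^sup>-\<^sup>1 s\<^sub>i (s\<^sub>i\<^sub>+\<^sub>1 \<cdots> s\<^sub>k)\<close> of the word \<open>s\<^sub>1 \<cdots> s\<^sub>k\<close>. Multiplying the word by
  such a reflection deletes the letter \<open>s\<^sub>i\<close>.\<close>

fun inv_par :: "'a list \<Rightarrow> 'a \<Rightarrow> bool" where
  "inv_par [] t = False"
| "inv_par (s # xs) t = ((t = inv (word xs) \<otimes> s \<otimes> word xs) \<noteq> inv_par xs t)"

lemma conj_eq_iff:
  assumes "x \<in> carrier G" "y \<in> carrier G" "t \<in> carrier G"
  shows "t = inv y \<otimes> x \<otimes> y \<longleftrightarrow> y \<otimes> t \<otimes> inv y = x"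
  using assms by (auto simp: m_assoc)

text \<open>In the concatenation, the reflections belonging to letters of \<open>xs\<close> are
  those of \<open>xs\<close> itself conjugated by \<open>word ys\<close>. Testing for
  \<open>t\<close> therefore amounts to testing \<open>xs\<close> for the conjugate of
  \<open>t\<close>.\<close>

lemma inv_par_append:
  assumes "xs \<in> lists S" "ys \<in> lists S" "t \<in> carrier G"
  shows "inv_par (xs @ ys) t \<longleftrightarrow>
    (inv_par xs (word ys \<otimes> t \<otimes> inv (word ys)) \<noteq> inv_par ys t)"
  using assms(1)
proof (induction xs)
  case (Cons s xs)
  have "t = inv (word (xs @ ys)) \<otimes> s \<otimes> word (xs @ ys) \<longleftrightarrow>
     word ys \<otimes> t \<otimes> inv (word ys) = inv (word xs) \<otimes> s \<otimes> word xs"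
    using Cons assms(2,3) by (subst conj_eq_iff, simp_all)
      (subst conj_eq_iff, simp_all add: word_append inv_mult_group m_assoc)
  with Cons show ?case by auto
qed auto

lemma word_alternating:
  assumes "s \<in> S" "t \<in> S"
  shows "word (concat (replicate n [s, t])) = (s \<otimes> t) [^] n"
proof (induction n)
  case (Suc n)
  then show ?case using assms nat_pow_Suc2[of "s \<otimes> t" n] by (simp add: m_assoc)
qed simp

lemma alternating_in_lists: "s \<in> A \<Longrightarrow> t \<in> A \<Longrightarrow> concat (replicate n [s, t]) \<in> lists A"
  by (induction n) auto

text \<open>Conjugation by \<open>t\<close> inverts the rotation \<open>s t\<close> of the dihedral
  group generated by \<open>s\<close> and \<open>t\<close>.\<close>

lemma dihedral_conj:
  assumes "s \<in> S" "t \<in> S"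
  shows "inv ((s \<otimes> t) [^] n) \<otimes> t = t \<otimes> (s \<otimes> t) [^] (n::nat)"
proof (induction n)
  case (Suc n)
  let ?c = "s \<otimes> t"
  have "inv (?c [^] Suc n) \<otimes> t = inv ?c \<otimes> (inv (?c [^] n) \<otimes> t)"
    using assms by (simp add: inv_mult_group m_assoc)
  also have "\<dots> = t \<otimes> (?c \<otimes> ?c [^] n)"
    using assms by (simp add: Suc inv_mult_group m_assoc)
  also have "?c \<otimes> ?c [^] n = ?c [^] Suc n"
    using assms nat_pow_Suc2[of ?c n] by simp
  finally show ?case .
qed (use assms in simp)

text \<open>The reflections of the alternating word \<open>(st)\<^sup>n\<close>, read from the right, are
  \<open>t(st)\<^sup>j\<close> for \<open>j < 2n\<close>.\<close>

lemma inv_par_alternating: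
  assumes "s \<in> S" "t \<in> S" "r \<in> carrier G"
  shows "inv_par (concat (replicate n [s, t])) r \<longleftrightarrow>
    odd (\<Sum>j<2*n. if r = t \<otimes> (s \<otimes> t) [^] (j::nat) then 1 else 0::nat)"
proof (induction n)
  case (Suc n)
  let ?c = "s \<otimes> t"
  have c: "?c \<in> carrier G" using assms by simp
  have 1: "inv (?c [^] n) \<otimes> t \<otimes> ?c [^] n = t \<otimes> ?c [^] (2 * n)"
    using assms c by (simp add: dihedral_conj m_assoc nat_pow_mult mult_2)
  have "inv (t \<otimes> ?c [^] n) \<otimes> s \<otimes> (t \<otimes> ?c [^] n) = (inv (?c [^] n) \<otimes> t) \<otimes> (?c \<otimes> ?c [^] n)"
    using assms c by (simp add: inv_mult_group m_assoc)
  also have "\<dots> = t \<otimes> (?c [^] n \<otimes> ?c [^] Suc n)"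
    using assms c by (subst nat_pow_Suc2) (simp_all add: dihedral_conj m_assoc)
  also have "\<dots> = t \<otimes> ?c [^] (Suc (2 * n))"
    using nat_pow_mult[OF c, of n "Suc n"] by (simp add: mult_2)
  finally have 2: "inv (t \<otimes> ?c [^] n) \<otimes> s \<otimes> (t \<otimes> ?c [^] n) = t \<otimes> ?c [^] (Suc (2 * n))" .
  show ?case using assms Suc 1 2 by (simp add: word_alternating)
qed simp

text \<open>With \<open>m\<close> the order of \<open>s t\<close>, the reflections
  \<open>t (s t)^j\<close> have period \<open>m\<close> in \<open>j\<close>. The range
  \<open>j < 2 * m\<close> covers two periods, so every reflection is counted an even number of
  times. For infinite order \<open>m\<close> is 0 and the word is empty.\<close>

lemma inv_par_relator:
  assumes "s \<in> S" "t \<in> S" "r \<in> carrier G"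
  shows "\<not> inv_par (concat (replicate (ord (s \<otimes> t)) [s, t])) r"
proof -
  let ?c = "s \<otimes> t" and ?m = "ord (s \<otimes> t)"
  let ?f = "\<lambda>j. if r = t \<otimes> ?c [^] (j::nat) then 1 else 0::nat"
  have "?f (?m + j) = ?f j" for j
  proof -
    have "?c [^] (?m + j) = ?c [^] j"
      using assms by (simp add: pow_ord_eq_1 flip: nat_pow_mult)
    then show ?thesis by simp
  qed
  then have "(\<Sum>j<?m + k. ?f j) = (\<Sum>j<?m. ?f j) + (\<Sum>j<k. ?f j)" for k
    by (induction k) simp_all
  from this[of ?m] have "even (\<Sum>j<2 * ?m. ?f j)" by (simp add: mult_2)
  then show ?thesis using inv_par_alternating[OF assms] by simp
qed

text \<open>The relator has value \<open>\<one>\<close>, so it does not change the conjugating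
  suffix of the letters before it, and its own contribution is even.\<close>

lemma inv_par_relator_insertion:
  assumes "(u, v) \<in> relator_insertions G S" "t \<in> carrier G"
  shows "inv_par u t = inv_par v t"
proof -
  obtain x y a b where *: "u = x @ y" "v = x @ concat (replicate (ord (a \<otimes> b)) [a, b]) @ y"
    "x \<in> lists S" "y \<in> lists S" "a \<in> S" "b \<in> S"
    using assms(1) unfolding relator_insertions_def by blast
  let ?r = "concat (replicate (ord (a \<otimes> b)) [a, b])"
  have r: "?r \<in> lists S" "word ?r = \<one>"
    using * by (auto simp: alternating_in_lists word_alternating pow_ord_eq_1 simp del: lists_eq_set)
  have "\<not> inv_par ?r (word y \<otimes> t \<otimes> inv (word y))"
    using * assms by (intro inv_par_relator) auto
  then show ?thesis
    using * r assms by (simp add: inv_par_append word_append)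
qed

text \<open>The parity is a function of the group element alone. This is where the presentation by
  the Coxeter relations enters.\<close>

lemma inv_par_cong:
  assumes "u \<in> lists S" "v \<in> lists S" "word u = word v" "t \<in> carrier G"
  shows "inv_par u t = inv_par v t"
proof -
  have "(u, v) \<in> (relator_insertions G S \<union> (relator_insertions G S)\<inverse>)\<^sup>*"
    using coxeter_system assms unfolding coxeter_system_def by blast
  then show ?thesis
    by (induction rule: rtrancl_induct) (use inv_par_relator_insertion assms(4) in auto)
qed

text \<open>An odd count forces at least one occurrence of \<open>t\<close>, and the letter at that
  occurrence is the one deleted.\<close>

lemma inv_par_deletion:
  assumes "xs \<in> lists S" "inv_par xs t" "t \<in> carrier G"
  shows "\<exists>us s vs. xs = us @ s # vs \<and> word xs \<otimes> t = word (us @ vs)"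
  using assms(1,2)
proof (induction xs)
  case (Cons s xs)
  show ?case
  proof (cases "inv_par xs t")
    case True
    then obtain us a vs where *: "xs = us @ a # vs" "word xs \<otimes> t = word (us @ vs)"
      using Cons by auto
    then have "word (s # xs) \<otimes> t = word ((s # us) @ vs)"
      using Cons assms(3) by (simp add: m_assoc)
    then show ?thesis using * by (metis append_Cons)
  next
    case False
    then have "t = inv (word xs) \<otimes> s \<otimes> word xs" using Cons by auto
    moreover have "s \<in> S" "xs \<in> lists S" using Cons.hyps by auto
    ultimately have "word (s # xs) \<otimes> t = word ([] @ xs)" by (simp add: m_assoc)
    then show ?thesis by blast
  qed
qed simp

text \<open>For \<open>t = w s w^-1\<close> and a word \<open>u\<close> of \<open>w\<close>, the
  word \<open>u @ [s] @ rev u\<close> has value \<open>t\<close>. Its middle letter contributes one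
  occurrence of \<open>t\<close>. The contributions of \<open>u\<close> and \<open>rev u\<close>
  have equal parity, because \<open>u @ rev u\<close> represents the identity and must have even
  parity.\<close>

lemma inv_par_reflection:
  assumes "t \<in> refls" "xs \<in> lists S" "word xs = t"
  shows "inv_par xs t"
proof -
  obtain w s where *: "w \<in> carrier G" "s \<in> S" "t = w \<otimes> s \<otimes> inv w"
    using assms(1) by (rule reflectionE)
  obtain u where u: "u \<in> lists S" "word u = w"
    using * carrier_eq_words by auto
  have t: "t \<in> carrier G" using assms by auto
  have s: "s \<in> carrier G" using * by simp
  have wt: "inv w \<otimes> (t \<otimes> w) = s" "\<And>y. y \<in> carrier G \<Longrightarrow> inv w \<otimes> (t \<otimes> (w \<otimes> y)) = s \<otimes> y"
    unfolding *(3) using *(1,2) by (simp_all add: m_assoc)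
  have tw: "t = w \<otimes> (s \<otimes> inv w)" using * by (simp add: m_assoc)
  have "inv_par xs t = inv_par (u @ [s] @ rev u) t"
    using assms(2,3) u *(2) t
    by (intro inv_par_cong) (simp_all add: word_append word_rev flip: tw)
  also have "\<dots> = (inv_par u s \<noteq> (\<not> inv_par (rev u) t))"
    using u(1) *(1,2) t
    by (simp add: inv_par_append word_append word_rev m_assoc inv_mult_group u(2) wt tw[symmetric])
  also have "inv_par (rev u) t = inv_par u s"
  proof -
    have "inv_par (u @ rev u) t = inv_par [] t"
      using u t *(1) by (intro inv_par_cong) (simp_all add: word_append word_rev)
    then show ?thesis using u(1) t *(1)
      by (simp add: inv_par_append word_append word_rev u(2) m_assoc wt)
  qed
  finally show ?thesis by simp
qed

text \<open>Odd parity permits a deletion in a reduced word of the same element, which shortens it.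
  Right multiplication by \<open>t\<close> flips the parity, so if the parity is even, the same
  argument applied to \<open>word xs \<otimes> t\<close> shows that this product is the longer
  one.\<close>

lemma inv_par_iff_len:
  assumes "t \<in> refls" "xs \<in> lists S"
  shows "inv_par xs t \<longleftrightarrow> len (word xs \<otimes> t) < len (word xs)"
proof -
  have less: "len (word xs \<otimes> t) < len (word xs)" if xs: "xs \<in> lists S" "inv_par xs t" for xs
  proof -
    obtain ys where ys: "ys \<in> lists S" "word ys = word xs" "length ys = len (word xs)"
      using reduced_word[OF word_closed[OF xs(1)]] by blast
    have "inv_par ys t"
      using inv_par_cong[OF ys(1) xs(1) ys(2) reflection_closed[OF assms(1)]] xs(2) by simp
    then obtain us s vs where *: "ys = us @ s # vs" "word ys \<otimes> t = word (us @ vs)"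
      using inv_par_deletion[OF ys(1) _ reflection_closed[OF assms(1)]] by blast
    then show ?thesis using len_word_le[of "us @ vs"] ys by simp
  qed
  moreover have "inv_par xs t" if *: "len (word xs \<otimes> t) < len (word xs)"
  proof (rule ccontr)
    assume "\<not> inv_par xs t"
    obtain ts where ts: "ts \<in> lists S" "word ts = t"
      using reduced_word[OF reflection_closed[OF assms(1)]] by blast
    have "inv_par (xs @ ts) t"
      using \<open>\<not> inv_par xs t\<close> inv_par_reflection[OF assms(1) ts] ts assms
      by (simp add: inv_par_append m_assoc)
    then have "len (word xs \<otimes> t \<otimes> t) < len (word xs \<otimes> t)"
      using less[of "xs @ ts"] ts assms by (simp add: word_append)
    then show False using * assms by (simp add: m_assoc reflection_square)
  qed
  ultimately show ?thesis using assms(2) by blast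
qed

lemma strong_exchange:
  assumes "t \<in> refls" "xs \<in> lists S" "len (word xs \<otimes> t) < len (word xs)"
  obtains us s vs where "xs = us @ s # vs" "word xs \<otimes> t = word (us @ vs)"
proof -
  have "inv_par xs t" using assms by (simp add: inv_par_iff_len)
  then show ?thesis using inv_par_deletion[of xs t] assms that by auto
qed

text \<open>Equal lengths would make the parity of \<open>t\<close> even for both \<open>x\<close>
  and \<open>x \<otimes> t\<close>, although multiplication by \<open>t\<close> flips it.\<close>

lemma len_mult_reflection_neq:
  assumes "t \<in> refls" "x \<in> carrier G" shows "len (x \<otimes> t) \<noteq> len x"
proof
  assume eq: "len (x \<otimes> t) = len x"
  obtain xs where xs: "xs \<in> lists S" "word xs = x"
    using reduced_word[OF assms(2)] by blast
  obtain ts where ts: "ts \<in> lists S" "word ts = t"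
    using reduced_word[OF reflection_closed[OF assms(1)]] by blast
  have "inv_par (xs @ ts) t \<longleftrightarrow> \<not> inv_par xs t"
    using inv_par_reflection[OF assms(1) ts] ts xs assms by (simp add: inv_par_append m_assoc)
  moreover have "len (word (xs @ ts) \<otimes> t) = len (word (xs @ ts))"
    using eq xs ts assms by (simp add: word_append m_assoc reflection_square)
  ultimately show False
    using inv_par_iff_len[OF assms(1), of xs] inv_par_iff_len[OF assms(1), of "xs @ ts"]
      eq xs ts by simp
qed

lemma len_mult_generator_right:
  assumes "s \<in> S" "x \<in> carrier G"
  shows "len (x \<otimes> s) = Suc (len x) \<or> len x = Suc (len (x \<otimes> s))"
proof -
  have "len (x \<otimes> s) \<le> len x + 1"
    using len_mult_le[of x s] len_generator_le[of s] assms by simp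
  moreover have "len (x \<otimes> s \<otimes> s) \<le> len (x \<otimes> s) + 1"
    using len_mult_le[of "x \<otimes> s" s] len_generator_le[of s] assms by simp
  moreover have "len (x \<otimes> s) \<noteq> len x"
    using assms by (simp add: len_mult_reflection_neq generator_reflection)
  ultimately show ?thesis using assms by auto
qed

lemma len_inv_mult:
  assumes "s \<in> S" "x \<in> carrier G" shows "len (s \<otimes> x) = len (inv x \<otimes> s)"
  using len_inv[of "s \<otimes> x"] assms by (simp add: inv_mult_group)

lemma len_mult_generator:
  assumes "s \<in> S" "x \<in> carrier G"
  shows "len (s \<otimes> x) = Suc (len x) \<or> len x = Suc (len (s \<otimes> x))"
  using len_mult_generator_right[of s "inv x"] assms by (simp add: len_inv_mult)

subsection \<open>The Bruhat order\<close>

lemma bruhat_refl [simp]: "x \<preceq> x"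
  by (simp add: bruhat_le_def)

lemma bruhat_trans: "x \<preceq> y \<Longrightarrow> y \<preceq> z \<Longrightarrow> x \<preceq> z"
  unfolding bruhat_le_def by (rule rtrancl_trans)

lemma bruhat_reflection:
  assumes "x \<in> carrier G" "t \<in> refls" "len x < len (x \<otimes> t)" shows "x \<preceq> x \<otimes> t"
  unfolding bruhat_le_def using assms by (intro r_into_rtrancl) blast

lemma bruhat_induct [consumes 1, case_names refl step]:
  assumes "x \<preceq> y" "P x"
    and "\<And>y t. x \<preceq> y \<Longrightarrow> P y \<Longrightarrow> y \<in> carrier G \<Longrightarrow> t \<in> refls \<Longrightarrow>
      len y < len (y \<otimes> t) \<Longrightarrow> P (y \<otimes> t)"
  shows "P y"
  using assms(1,2) unfolding bruhat_le_def
proof (induction rule: rtrancl_induct)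
  case (step y z)
  then obtain t where "z = y \<otimes> t" "y \<in> carrier G" "t \<in> refls" "len y < len (y \<otimes> t)" by blast
  then show ?case using step assms(3)[of y t] by (simp add: bruhat_le_def)
qed

lemma bruhat_len: assumes "x \<preceq> y" shows "x = y \<or> len x < len y"
  using assms by (induction rule: bruhat_induct) auto

lemma bruhat_antisym: "x \<preceq> y \<Longrightarrow> y \<preceq> x \<Longrightarrow> x = y"
  using bruhat_len[of x y] bruhat_len[of y x] by auto

text \<open>Inversion turns a step by \<open>t\<close> into a step by a conjugate reflection:
  \<open>(y t)^-1 = y^-1 (y t y^-1)\<close>.\<close>

lemma bruhat_inv:
  assumes "x \<preceq> y" "x \<in> carrier G" shows "inv x \<preceq> inv y"
  using assms(1)
proof (induction rule: bruhat_induct)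
  case (step y t)
  have "inv (y \<otimes> t) = inv y \<otimes> (y \<otimes> t \<otimes> inv y)"
    using step by (simp add: inv_mult_group reflection_inv m_assoc)
  moreover have "inv y \<preceq> inv y \<otimes> (y \<otimes> t \<otimes> inv y)"
    using step calculation by (intro bruhat_reflection conj_reflection) (simp_all flip: calculation)
  ultimately show ?case using step bruhat_trans by metis
qed simp

text \<open>The order is generated by right multiplications; left multiplication by \<open>s\<close>
  is right multiplication by the reflection \<open>x^-1 s x\<close>.\<close>

lemma bruhat_mult_generator:
  assumes "s \<in> S" "x \<in> carrier G" "len x < len (s \<otimes> x)" shows "x \<preceq> s \<otimes> x"
proof -
  have eq: "x \<otimes> (inv x \<otimes> s \<otimes> x) = s \<otimes> x"
    using assms by (simp add: m_assoc)
  have "inv x \<otimes> s \<otimes> x \<in> refls"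
    using conj_reflection[OF generator_reflection[OF assms(1)], of "inv x"] assms(2) by simp
  then show ?thesis using bruhat_reflection[OF assms(2)] assms(3) by (metis eq)
qed

text \<open>If \<open>s x t\<close> is shorter than \<open>s x\<close>, strong exchange deletes a
  letter from \<open>s # xs\<close>. Deleting the first letter gives \<open>s x t = x\<close>.
  Deleting a later one would give a word for \<open>x t\<close> with fewer letters than
  \<open>len x\<close>.\<close>

lemma lifting:
  assumes "s \<in> S" "t \<in> refls" "x \<in> carrier G" "len x < len (s \<otimes> x)" "len x < len (x \<otimes> t)"
  shows "len (s \<otimes> x) < len (s \<otimes> x \<otimes> t) \<or> s \<otimes> x \<otimes> t = x"
proof (rule ccontr)
  assume neg: "\<not> ?thesis"
  obtain xs where xs: "xs \<in> lists S" "word xs = x" "length xs = len x"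
    using reduced_word assms by blast
  have "len (s \<otimes> x \<otimes> t) < len (s \<otimes> x)"
    using neg len_mult_reflection_neq[of t "s \<otimes> x"] assms by simp
  then obtain us a vs where del: "s # xs = us @ a # vs" "word (s # xs) \<otimes> t = word (us @ vs)"
    using strong_exchange[of t "s # xs"] assms xs by auto
  show False
  proof (cases us)
    case Nil
    then show False using del xs neg by simp
  next
    case (Cons b us')
    then have *: "xs = us' @ a # vs" "s \<otimes> x \<otimes> t = s \<otimes> word (us' @ vs)" "us' @ vs \<in> lists S"
      using del xs by auto
    then have "s \<otimes> (s \<otimes> x \<otimes> t) = s \<otimes> (s \<otimes> word (us' @ vs))" by simp
    then have "x \<otimes> t = word (us' @ vs)" using * assms(1-3) by (simp add: m_assoc)
    then show False using len_word_le[OF *(3)] * xs assms(5) by simp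
  qed
qed

text \<open>\<open>up s\<close> and \<open>upr _ s\<close> turn out to be left and right star
  multiplication by \<open>s\<close>. They are studied first, because the existence of the star
  product is derived from them.\<close>

definition up :: "'a \<Rightarrow> 'a \<Rightarrow> 'a" where
  "up s x = (if len x < len (s \<otimes> x) then s \<otimes> x else x)"

definition down :: "'a \<Rightarrow> 'a \<Rightarrow> 'a" where
  "down s x = (if len x < len (s \<otimes> x) then x else s \<otimes> x)"

definition upr :: "'a \<Rightarrow> 'a \<Rightarrow> 'a" where
  "upr x s = (if len x < len (x \<otimes> s) then x \<otimes> s else x)"

lemma up_closed [simp]: "s \<in> S \<Longrightarrow> x \<in> carrier G \<Longrightarrow> up s x \<in> carrier G"
  by (simp add: up_def)

lemma upr_closed [simp]: "s \<in> S \<Longrightarrow> x \<in> carrier G \<Longrightarrow> upr x s \<in> carrier G"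
  by (simp add: upr_def)

lemma upr_eq_up: "s \<in> S \<Longrightarrow> x \<in> carrier G \<Longrightarrow> upr x s = inv (up s (inv x))"
  by (simp add: up_def upr_def len_inv_mult inv_mult_group)

lemma bruhat_mult_up:
  assumes "s \<in> S" "x \<in> carrier G" shows "s \<otimes> x \<preceq> up s x"
proof (cases "len x < len (s \<otimes> x)")
  case False
  then have "len (s \<otimes> x) < len (s \<otimes> (s \<otimes> x))" using len_mult_generator[of s x] assms by auto
  then show ?thesis
    using False bruhat_mult_generator[of s "s \<otimes> x"] assms by (simp add: up_def)
qed (simp add: up_def)

lemma bruhat_down_mult: "s \<in> S \<Longrightarrow> x \<in> carrier G \<Longrightarrow> down s x \<preceq> s \<otimes> x"
  by (simp add: down_def bruhat_mult_generator)

text \<open>Left multiplication by \<open>s\<close> carries the edge from \<open>x\<close> to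
  \<open>x t\<close> to an edge labelled by the same \<open>t\<close>, unless \<open>s\<close>
  interchanges its two ends. The lifting lemma separates these cases when \<open>s\<close> lengthens
  \<open>x\<close>.\<close>

lemma bruhat_generator_step:
  assumes "s \<in> S" "t \<in> refls" "x \<in> carrier G" "len x < len (x \<otimes> t)"
  shows "up s x \<preceq> up s (x \<otimes> t)" "down s x \<preceq> down s (x \<otimes> t)"
proof -
  let ?y = "x \<otimes> t"
  have c: "?y \<in> carrier G" "s \<otimes> x \<in> carrier G" using assms by simp_all
  have xy: "x \<preceq> ?y" using assms by (simp add: bruhat_reflection)
  have ly: "len (s \<otimes> ?y) = Suc (len ?y) \<or> len ?y = Suc (len (s \<otimes> ?y))"
    and lx: "len (s \<otimes> x) = Suc (len x) \<or> len x = Suc (len (s \<otimes> x))"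
    using len_mult_generator assms c by blast+
  have edge: "s \<otimes> x \<preceq> s \<otimes> ?y" if "len (s \<otimes> x) < len (s \<otimes> ?y)"
    using bruhat_reflection[of "s \<otimes> x" t] that assms by (simp add: m_assoc)
  have lift: "len (s \<otimes> x) < len (s \<otimes> ?y) \<or> s \<otimes> ?y = x" if "len x < len (s \<otimes> x)"
    using lifting[of s t x] that assms by (simp add: m_assoc)
  have y_up: "?y \<preceq> s \<otimes> ?y" if "len ?y < len (s \<otimes> ?y)"
    using that bruhat_mult_generator assms c by blast
  have y_down: "s \<otimes> ?y \<preceq> ?y" if "\<not> len ?y < len (s \<otimes> ?y)"
    using bruhat_mult_up[OF assms(1) c(1)] that by (simp add: up_def)
  have x_up: "x \<preceq> s \<otimes> x" if "len x < len (s \<otimes> x)"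
    using that bruhat_mult_generator assms c by blast
  have x_down: "s \<otimes> x \<preceq> x" if "\<not> len x < len (s \<otimes> x)"
    using bruhat_mult_up[OF assms(1,3)] that by (simp add: up_def)
  show "up s x \<preceq> up s ?y"
  proof (cases "len x < len (s \<otimes> x)")
    case up: True
    consider "len (s \<otimes> x) < len (s \<otimes> ?y)" | "s \<otimes> ?y = x" using lift[OF up] by blast
    then show ?thesis
    proof cases
      case 1
      then show ?thesis
        using edge y_down up bruhat_trans[of "s \<otimes> x" "s \<otimes> ?y" ?y] by (simp add: up_def)
    next
      case 2
      then have "s \<otimes> x = ?y" using assms c by (metis S_cancel)
      then show ?thesis using 2 up assms(4) by (simp add: up_def)
    qed
  next
    case False
    then show ?thesis using xy bruhat_trans[OF xy y_up] by (simp add: up_def)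
  qed
  show "down s x \<preceq> down s ?y"
  proof (cases "len x < len (s \<otimes> x)")
    case up: True
    consider "len (s \<otimes> x) < len (s \<otimes> ?y)" | "s \<otimes> ?y = x" using lift[OF up] by blast
    then show ?thesis
    proof cases
      case 1
      have "x \<preceq> s \<otimes> ?y" by (rule bruhat_trans[OF x_up[OF up] edge[OF 1]])
      then show ?thesis using xy up by (simp add: down_def)
    next
      case 2
      then show ?thesis using up xy by (simp add: down_def)
    qed
  next
    case False
    have "len (s \<otimes> x) < len (s \<otimes> ?y)" using False lx ly assms(4) by auto
    then show ?thesis
      using False edge bruhat_trans[OF x_down[OF False] xy] by (simp add: down_def)
  qed
qed

lemma up_mono:
  assumes "x \<preceq> y" "s \<in> S" "x \<in> carrier G" shows "up s x \<preceq> up s y"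
  using assms(1) by (induction rule: bruhat_induct)
    (use bruhat_trans bruhat_generator_step(1)[OF assms(2)] in \<open>blast intro: bruhat_refl\<close>)+

lemma down_mono:
  assumes "x \<preceq> y" "s \<in> S" "x \<in> carrier G" shows "down s x \<preceq> down s y"
  using assms(1) by (induction rule: bruhat_induct)
    (use bruhat_trans bruhat_generator_step(2)[OF assms(2)] in \<open>blast intro: bruhat_refl\<close>)+

lemma bruhat_closed: assumes "x \<preceq> y" "x \<in> carrier G" shows "y \<in> carrier G"
  using assms(1) by (induction rule: bruhat_induct) (use assms(2) in auto)

lemma upr_mono:
  assumes "x \<preceq> y" "s \<in> S" "x \<in> carrier G" shows "upr x s \<preceq> upr y s"
  using assms bruhat_closed[of x y] by (simp add: upr_eq_up bruhat_inv up_mono)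

subsection \<open>The star product\<close>

abbreviation star_prod (infixl "\<star>" 70) where "x \<star> y \<equiv> star G S x y"

text \<open>Lengths alone settle all cases except the one where both \<open>s x\<close> and
  \<open>x t\<close> are longer than \<open>x\<close>. There lifting leaves two possibilities:
  \<open>s x t\<close> is longer still, or \<open>s x t = x\<close>, in which case
  \<open>s x = x t\<close>.\<close>

lemma up_upr_commute:
  assumes "s \<in> S" "t \<in> S" "x \<in> carrier G"
  shows "up s (upr x t) = upr (up s x) t"
proof -
  have ls: "len (s \<otimes> x) = Suc (len x) \<or> len x = Suc (len (s \<otimes> x))"
    and lt: "len (x \<otimes> t) = Suc (len x) \<or> len x = Suc (len (x \<otimes> t))"
    and lst: "len (s \<otimes> (x \<otimes> t)) = Suc (len (x \<otimes> t)) \<or> len (x \<otimes> t) = Suc (len (s \<otimes> (x \<otimes> t)))"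
    and lts: "len (s \<otimes> (x \<otimes> t)) = Suc (len (s \<otimes> x)) \<or> len (s \<otimes> x) = Suc (len (s \<otimes> (x \<otimes> t)))"
    using assms len_mult_generator[of s x] len_mult_generator_right[of t x]
      len_mult_generator[of s "x \<otimes> t"] len_mult_generator_right[of t "s \<otimes> x"]
    by (simp_all add: m_assoc)
  show ?thesis
  proof (cases "len x < len (s \<otimes> x) \<and> len x < len (x \<otimes> t)")
    case True
    then consider "len (s \<otimes> x) < len (s \<otimes> (x \<otimes> t))" | "s \<otimes> (x \<otimes> t) = x"
      using lifting[of s t x] assms by (auto simp: generator_reflection m_assoc)
    then show ?thesis
    proof cases
      case 1
      then show ?thesis using True ls lt lst lts assms by (auto simp: up_def upr_def m_assoc)
    next
      case 2
      then have "x \<otimes> t = s \<otimes> x" using S_cancel[of s "x \<otimes> t"] assms by simp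
      then show ?thesis using True 2 by (simp add: up_def upr_def m_assoc assms)
    qed
  next
    case False
    then show ?thesis using ls lt lst lts assms by (auto simp: up_def upr_def m_assoc)
  qed
qed

lemma foldr_up_closed [simp]: "xs \<in> lists S \<Longrightarrow> x \<in> carrier G \<Longrightarrow> foldr up xs x \<in> carrier G"
  by (induction xs) auto

lemma foldr_up_upr:
  "xs \<in> lists S \<Longrightarrow> t \<in> S \<Longrightarrow> x \<in> carrier G \<Longrightarrow> foldr up xs (upr x t) = upr (foldr up xs x) t"
  by (induction xs) (auto simp: up_upr_commute)

lemma descent_right:
  assumes "x \<in> carrier G" "x \<noteq> \<one>"
  obtains y t where "y \<in> carrier G" "t \<in> S" "x = y \<otimes> t" "len y < len x"
proof -
  obtain ts where ts: "ts \<in> lists S" "word ts = x" "length ts = len x"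
    using reduced_word assms by blast
  then have "ts \<noteq> []" using assms by auto
  then obtain us t where us: "ts = us @ [t]" by (metis append_butlast_last_id)
  then have "us \<in> lists S" "t \<in> S" "x = word us \<otimes> t" "len (word us) < len x"
    using ts len_word_le[of us] by (auto simp: word_append)
  then show ?thesis using that word_closed by blast
qed

text \<open>Every \<open>x\<close> is obtained from \<open>\<one>\<close> by successive applications
  of \<open>upr\<close>, and these commute with \<open>foldr up xs\<close>. Such an operator is thus
  known from its value at \<open>\<one>\<close>, which is the source of associativity below.\<close>

lemma foldr_up_determined:
  assumes "xs \<in> lists S" "ys \<in> lists S" "foldr up xs \<one> = foldr up ys \<one>" "x \<in> carrier G"
  shows "foldr up xs x = foldr up ys x"
  using assms(4)
proof (induction "len x" arbitrary: x rule: less_induct)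
  case less
  show ?case
  proof (cases "x = \<one>")
    case False
    then obtain y t where y: "y \<in> carrier G" "t \<in> S" "x = y \<otimes> t" "len y < len x"
      using descent_right less.prems by blast
    then have "x = upr y t" by (simp add: upr_def)
    then show ?thesis using less.hyps[of y] y assms(1,2) by (simp add: foldr_up_upr)
  qed (use assms in simp)
qed

text \<open>The length hypothesis leaves no slack: each letter must raise the length by one, so each
  \<open>up\<close> actually multiplies.\<close>

lemma foldr_up_additive:
  assumes "xs \<in> lists S" "y \<in> carrier G" "length xs + len y \<le> len (word xs \<otimes> y)"
  shows "foldr up xs y = word xs \<otimes> y"
  using assms(1,3)
proof (induction xs)
  case (Cons s xs)
  have c: "word xs \<otimes> y \<in> carrier G" using Cons assms by simp
  have "len (word xs \<otimes> y) \<le> length xs + len y"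
    using len_mult_le[of "word xs" y] len_word_le[of xs] Cons assms by simp
  moreover have "len (s \<otimes> (word xs \<otimes> y)) \<le> Suc (len (word xs \<otimes> y))"
    using len_mult_generator[OF _ c, of s] Cons by auto
  ultimately show ?case using Cons assms by (simp add: up_def m_assoc)
qed (use assms in simp)

lemma foldr_up_reduced: "xs \<in> lists S \<Longrightarrow> length xs = len (word xs) \<Longrightarrow> foldr up xs \<one> = word xs"
  using foldr_up_additive[of xs \<one>] by simp

lemma len_generator: "s \<in> S \<Longrightarrow> 0 < len s"
  using len_mult_generator[of s \<one>] by auto

lemma up_one: "s \<in> S \<Longrightarrow> up s \<one> = s" and upr_one: "s \<in> S \<Longrightarrow> upr \<one> s = s"
  by (simp_all add: up_def upr_def len_generator)

text \<open>The witness lets \<open>u\<close> act by \<open>foldr up\<close> along a chosen reduced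
  word of \<open>u\<close>. Since \<open>star\<close> is defined by choice, existence is what gives
  access to its properties.\<close>

lemma ex_star_product: "\<exists>m. is_star_product G S m"
proof -
  define rw where "rw u = (SOME xs. xs \<in> lists S \<and> word xs = u \<and> length xs = len u)" for u
  define m where "m u x = foldr up (rw u) x" for u x
  have rw: "rw u \<in> lists S" "word (rw u) = u" "length (rw u) = len u" if "u \<in> carrier G" for u
  proof -
    have "\<exists>xs. xs \<in> lists S \<and> word xs = u \<and> length xs = len u"
      using reduced_word[OF that] by blast
    from someI_ex[OF this] show "rw u \<in> lists S" "word (rw u) = u" "length (rw u) = len u"
      unfolding rw_def by blast+
  qed
  have one_right: "m u \<one> = u" if "u \<in> carrier G" for u
    using rw[OF that] by (simp add: m_def foldr_up_reduced)
  have one_left: "m \<one> u = u" if "u \<in> carrier G" for u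
    using rw[of \<one>] by (simp add: m_def)
  have closed: "m u v \<in> carrier G" if "u \<in> carrier G" "v \<in> carrier G" for u v
    using rw[OF that(1)] that by (simp add: m_def)
  have assoc: "m (m u v) w = m u (m v w)"
    if "u \<in> carrier G" "v \<in> carrier G" "w \<in> carrier G" for u v w
  proof -
    \<comment> \<open>Both operators send \<open>\<one>\<close> to \<open>m u v\<close>, so they
      agree everywhere; this is associativity.\<close>
    have "foldr up (rw (m u v)) \<one> = foldr up (rw u @ rw v) \<one>"
      using one_right[OF closed[OF that(1,2)]] one_right[OF that(2)] by (simp add: m_def)
    then have "foldr up (rw (m u v)) w = foldr up (rw u @ rw v) w"
      using that closed by - (rule foldr_up_determined, simp_all add: rw(1))
    then show ?thesis by (simp add: m_def)
  qed
  have gen: "m s w = up s w" if "s \<in> S" "w \<in> carrier G" for s w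
  proof -
    have "foldr up (rw s) \<one> = foldr up [s] \<one>"
      using one_right[of s] that by (simp add: m_def up_one)
    then have "foldr up (rw s) w = foldr up [s] w"
      using that by - (rule foldr_up_determined, simp_all add: rw(1))
    then show ?thesis by (simp add: m_def)
  qed
  have "monoid (G\<lparr>mult := m\<rparr>)"
    by standard (use one_left one_right closed assoc in simp_all)
  moreover have "up s w = s \<otimes> w" if "bruhat_less G S w (s \<otimes> w)" for s w
    using that bruhat_len by (auto simp: bruhat_less_def up_def)
  moreover have "up s w = w" if "bruhat_less G S (s \<otimes> w) w" for s w
    using that bruhat_len by (fastforce simp: bruhat_less_def up_def)
  ultimately have "is_star_product G S m" by (simp add: is_star_product_def gen)
  then show ?thesis by blast
qed

lemma is_star_product_star: "is_star_product G S (\<star>)"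
  unfolding star_def using someI_ex[OF ex_star_product] .

lemma star_closed [simp]: "x \<in> carrier G \<Longrightarrow> y \<in> carrier G \<Longrightarrow> x \<star> y \<in> carrier G"
  and star_assoc: "x \<in> carrier G \<Longrightarrow> y \<in> carrier G \<Longrightarrow> z \<in> carrier G \<Longrightarrow> x \<star> y \<star> z = x \<star> (y \<star> z)"
  and one_star [simp]: "x \<in> carrier G \<Longrightarrow> \<one> \<star> x = x"
  and star_one [simp]: "x \<in> carrier G \<Longrightarrow> x \<star> \<one> = x"
proof -
  interpret M: monoid "G\<lparr>mult := (\<star>)\<rparr>"
    using is_star_product_star by (simp add: is_star_product_def)
  show "x \<in> carrier G \<Longrightarrow> y \<in> carrier G \<Longrightarrow> x \<star> y \<in> carrier G"
    "x \<in> carrier G \<Longrightarrow> y \<in> carrier G \<Longrightarrow> z \<in> carrier G \<Longrightarrow> x \<star> y \<star> z = x \<star> (y \<star> z)"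
    "x \<in> carrier G \<Longrightarrow> \<one> \<star> x = x" "x \<in> carrier G \<Longrightarrow> x \<star> \<one> = x"
    using M.m_closed M.m_assoc M.l_one M.r_one by simp_all
qed

lemma star_generator:
  assumes "s \<in> S" "x \<in> carrier G" shows "s \<star> x = up s x"
proof (cases "len x < len (s \<otimes> x)")
  case True
  then have "bruhat_less G S x (s \<otimes> x)"
    using bruhat_mult_generator[OF assms] by (auto simp: bruhat_less_def)
  then show ?thesis
    using is_star_product_star assms True by (simp add: is_star_product_def up_def)
next
  case False
  then have "bruhat_less G S (s \<otimes> x) x"
    using bruhat_mult_up[OF assms] len_mult_generator[OF assms]
    by (auto simp: bruhat_less_def up_def)
  then show ?thesis
    using is_star_product_star assms False by (simp add: is_star_product_def up_def)
qed

lemma foldr_up_eq_star: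
  "xs \<in> lists S \<Longrightarrow> x \<in> carrier G \<Longrightarrow> foldr up xs x = foldr up xs \<one> \<star> x"
  by (induction xs) (auto simp: star_assoc simp flip: star_generator)

lemma foldr_up_word:
  assumes "u \<in> carrier G"
  obtains xs where "xs \<in> lists S" "foldr up xs \<one> = u" "length xs = len u"
  using reduced_word[OF assms] foldr_up_reduced by metis

text \<open>The characterization of the star product fixes only left multiplication by generators.
  The right-hand rule follows because \<open>up\<close> operators commute with
  \<open>upr\<close>.\<close>

lemma star_generator_right:
  assumes "s \<in> S" "x \<in> carrier G" shows "x \<star> s = upr x s"
proof -
  obtain xs where "xs \<in> lists S" "foldr up xs \<one> = x" using foldr_up_word assms(2) by blast
  then show ?thesis
    using foldr_up_eq_star[of xs s] foldr_up_upr[of xs s \<one>] assms by (simp add: upr_one)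
qed

lemma len_star_le:
  assumes "x \<in> carrier G" "y \<in> carrier G" shows "len (x \<star> y) \<le> len x + len y"
proof -
  obtain xs where xs: "xs \<in> lists S" "foldr up xs \<one> = x" "length xs = len x"
    using foldr_up_word assms(1) by blast
  have "len (foldr up xs y) \<le> length xs + len y" using xs(1)
  proof (induction xs)
    case (Cons s xs)
    then have "len (up s (foldr up xs y)) \<le> Suc (len (foldr up xs y))"
      using len_mult_generator[of s "foldr up xs y"] assms by (auto simp: up_def)
    then show ?case using Cons by simp
  qed simp
  then show ?thesis using xs foldr_up_eq_star[of xs y] assms by simp
qed

lemma star_eq_mult:
  assumes "x \<in> carrier G" "y \<in> carrier G" "len x + len y \<le> len (x \<otimes> y)"
  shows "x \<star> y = x \<otimes> y"
proof -
  obtain xs where "xs \<in> lists S" "word xs = x" "length xs = len x"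
    using reduced_word assms(1) by blast
  then show ?thesis
    using foldr_up_eq_star[of xs y] foldr_up_additive[of xs y] foldr_up_reduced[of xs] assms by simp
qed

lemma star_mono_right:
  assumes "y \<preceq> y'" "x \<in> carrier G" "y \<in> carrier G" shows "x \<star> y \<preceq> x \<star> y'"
proof -
  obtain xs where xs: "xs \<in> lists S" "foldr up xs \<one> = x" "length xs = len x"
    using foldr_up_word assms(2) by blast
  have "foldr up xs y \<preceq> foldr up xs y'" using xs(1)
    by (induction xs) (auto intro: up_mono simp: assms)
  then show ?thesis
    using xs(1,2) foldr_up_eq_star[of xs y] foldr_up_eq_star[of xs y'] bruhat_closed[OF assms(1,3)] assms(3)
    by simp
qed

text \<open>The right factor is moved over to the left one generator at a time by associativity, and
  each such move applies \<open>upr\<close>, which is monotone.\<close>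

lemma star_mono_left:
  assumes "x \<preceq> x'" "x \<in> carrier G" "y \<in> carrier G" shows "x \<star> y \<preceq> x' \<star> y"
proof -
  obtain ys where ys: "ys \<in> lists S" "foldr up ys \<one> = y"
    using foldr_up_word assms(3) by blast
  have "x \<star> foldr up ys \<one> \<preceq> x' \<star> foldr up ys \<one>" using ys(1) assms(1,2)
  proof (induction ys arbitrary: x x')
    case (Cons s ys)
    have c: "x' \<in> carrier G" using bruhat_closed Cons.prems by blast
    have *: "z \<star> foldr up (s # ys) \<one> = upr z s \<star> foldr up ys \<one>" if "z \<in> carrier G" for z
      using that Cons.hyps by (simp add: star_assoc flip: star_generator star_generator_right)
    show ?case
      unfolding *[OF c] *[OF Cons.prems(2)]
      using Cons.prems Cons.hyps by (intro Cons.IH upr_mono) auto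
  qed (use bruhat_closed in auto)
  then show ?thesis using ys by simp
qed

lemma star_mono:
  assumes "x \<preceq> x'" "y \<preceq> y'" "x \<in> carrier G" "y \<in> carrier G" shows "x \<star> y \<preceq> x' \<star> y'"
  using bruhat_trans[OF star_mono_left[OF assms(1,3,4)]] star_mono_right[OF assms(2) _ assms(4)]
    bruhat_closed[OF assms(1,3)] by blast

subsection \<open>Parabolic subgroups\<close>

text \<open>\<open>x\<close> is of maximal length in \<open>W\<^sub>A x\<close>, respectively in \<open>x W\<^sub>A\<close>.\<close>

definition lmax :: "'a set \<Rightarrow> 'a \<Rightarrow> bool" where
  "lmax A x \<longleftrightarrow> (\<forall>s\<in>A. len (s \<otimes> x) < len x)"

definition rmax :: "'a set \<Rightarrow> 'a \<Rightarrow> bool" where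
  "rmax A x \<longleftrightarrow> (\<forall>s\<in>A. len (x \<otimes> s) < len x)"

lemma generate_subset_carrier: "A \<subseteq> S \<Longrightarrow> generate G A \<subseteq> carrier G"
  using generate_incl[of A] S_carrier by blast

lemma lists_subset: "A \<subseteq> B \<Longrightarrow> xs \<in> lists A \<Longrightarrow> xs \<in> lists B"
  using lists_mono by blast

text \<open>Exchange only deletes letters, so a word over \<open>A\<close> can be shortened to a
  reduced word that still uses letters of \<open>A\<close> alone.\<close>

lemma reduced_word_generate:
  assumes "A \<subseteq> S" "x \<in> generate G A"
  obtains xs where "xs \<in> lists A" "word xs = x" "length xs = len x"
proof -
  have "\<exists>xs\<in>lists A. word xs = word ys \<and> length xs = len (word ys)" if "ys \<in> lists A" for ys
    using that
  proof (induction ys rule: rev_induct)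
    case (snoc s ys)
    then obtain xs where xs: "xs \<in> lists A" "word xs = word ys" "length xs = len (word ys)"
      by auto
    have s: "s \<in> A" "s \<in> S" and ys: "ys \<in> lists S" and xsS: "xs \<in> lists S"
      using snoc.prems assms(1) xs(1) lists_subset by auto
    have w: "word (ys @ [s]) = word xs \<otimes> s" using s ys xs by (simp add: word_append)
    from len_mult_generator_right[OF s(2) word_closed[OF xsS]]
    show ?case
    proof
      assume "len (word xs \<otimes> s) = Suc (len (word xs))"
      then show ?thesis using xs s xsS w by (intro bexI[of _ "xs @ [s]"]) (simp_all add: word_append)
    next
      assume *: "len (word xs) = Suc (len (word xs \<otimes> s))"
      then obtain us a vs where "xs = us @ a # vs" "word xs \<otimes> s = word (us @ vs)"
        using strong_exchange[of s xs] xsS s by (auto simp: generator_reflection)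
      then show ?thesis using * xs w by (intro bexI[of _ "us @ vs"]) simp_all
    qed
  qed simp
  moreover obtain ys where "ys \<in> lists A" "x = word ys"
    using assms generate_eq_words[OF assms(1)] by blast
  ultimately show ?thesis using that by metis
qed

lemma foldr_up_word_generate:
  assumes "A \<subseteq> S" "x \<in> generate G A"
  obtains xs where "xs \<in> lists A" "foldr up xs \<one> = x"
  using reduced_word_generate[OF assms] foldr_up_reduced lists_subset[OF assms(1)] by metis

text \<open>Turns a condition on lengths into fixed-point equations in the star monoid, to which
  associativity applies.\<close>

lemma lmax_iff_star:
  assumes "A \<subseteq> S" "x \<in> carrier G"
  shows "lmax A x \<longleftrightarrow> (\<forall>s\<in>A. s \<star> x = x)"
proof -
  have "len (s \<otimes> x) < len x \<longleftrightarrow> s \<star> x = x" if "s \<in> S" for s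
    using len_mult_generator[OF that assms(2)] that assms(2) by (auto simp: star_generator up_def)
  then show ?thesis using assms(1) unfolding lmax_def by blast
qed

lemma rmax_iff_star:
  assumes "A \<subseteq> S" "x \<in> carrier G"
  shows "rmax A x \<longleftrightarrow> (\<forall>s\<in>A. x \<star> s = x)"
proof -
  have "len (x \<otimes> s) < len x \<longleftrightarrow> x \<star> s = x" if "s \<in> S" for s
    using len_mult_generator_right[OF that assms(2)] that assms(2)
    by (auto simp: star_generator_right upr_def)
  then show ?thesis using assms(1) unfolding rmax_def by blast
qed

lemma lmax_star:
  assumes "A \<subseteq> S" "lmax A x" "x \<in> carrier G" "y \<in> carrier G" shows "lmax A (x \<star> y)"
proof -
  have "s \<star> (x \<star> y) = x \<star> y" if "s \<in> A" for s
  proof -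
    have "s \<star> x = x" using assms that lmax_iff_star by blast
    then show ?thesis using star_assoc[of s x y] that assms by auto
  qed
  then show ?thesis using lmax_iff_star assms by simp
qed

lemma rmax_star:
  assumes "A \<subseteq> S" "rmax A y" "x \<in> carrier G" "y \<in> carrier G" shows "rmax A (x \<star> y)"
proof -
  have "x \<star> y \<star> s = x \<star> y" if "s \<in> A" for s
  proof -
    have "y \<star> s = y" using assms that rmax_iff_star by blast
    then show ?thesis using star_assoc[of x y s] that assms by auto
  qed
  then show ?thesis using rmax_iff_star assms by simp
qed

lemma lmax_absorb:
  assumes "A \<subseteq> S" "lmax A x" "x \<in> carrier G" "u \<in> generate G A" shows "u \<star> x = x"
proof -
  obtain xs where xs: "xs \<in> lists A" "foldr up xs \<one> = u"
    using foldr_up_word_generate assms by blast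
  have "foldr up xs x = x" using xs(1)
    by (induction xs) (use assms lmax_iff_star in \<open>auto simp flip: star_generator\<close>)
  then show ?thesis using xs foldr_up_eq_star[of xs x] lists_subset[OF assms(1)] assms(3) by simp
qed

lemma rmax_absorb:
  assumes "A \<subseteq> S" "rmax A x" "x \<in> carrier G" "u \<in> generate G A" shows "x \<star> u = x"
proof -
  obtain xs where xs: "xs \<in> lists A" "foldr up xs \<one> = u"
    using foldr_up_word_generate assms by blast
  have "x \<star> foldr up xs \<one> = x" using xs(1)
  proof (induction xs)
    case (Cons s xs)
    have "s \<in> S" "xs \<in> lists S" using Cons assms(1) lists_subset by auto
    moreover have "x \<star> s = x" using Cons assms rmax_iff_star by auto
    ultimately show ?case
      using Cons.IH star_assoc[of x s "foldr up xs \<one>"] assms(3) by (simp flip: star_generator)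
  qed (use assms in simp)
  then show ?thesis using xs by simp
qed

lemma subgroup_generate: "A \<subseteq> S \<Longrightarrow> subgroup (generate G A) G"
  using S_carrier by (intro generate_is_subgroup) blast

lemma generate_mult: "A \<subseteq> S \<Longrightarrow> x \<in> generate G A \<Longrightarrow> y \<in> generate G A \<Longrightarrow> x \<otimes> y \<in> generate G A"
  using subgroup_generate subgroup.m_closed by metis

lemma generate_inv: "A \<subseteq> S \<Longrightarrow> x \<in> generate G A \<Longrightarrow> inv x \<in> generate G A"
  using subgroup_generate subgroup.m_inv_closed by metis

section \<open>Longest elements of finite parabolic subgroups\<close>

lemma max_len_lmax_rmax:
  assumes "A \<subseteq> S" "w \<in> generate G A" "\<forall>v\<in>generate G A. len v \<le> len w"
  shows "lmax A w" "rmax A w"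
proof -
  have w: "w \<in> carrier G" using assms generate_subset_carrier by blast
  have s: "s \<in> S" "s \<in> generate G A" if "s \<in> A" for s using that assms by (auto intro: generate.incl)
  show "lmax A w" unfolding lmax_def
  proof
    fix s assume "s \<in> A"
    from s[OF this] have "s \<in> S" "len (s \<otimes> w) \<le> len w"
      using assms(3) generate_mult[OF assms(1) _ assms(2)] by blast+
    then show "len (s \<otimes> w) < len w" using len_mult_generator[of s w] w by auto
  qed
  show "rmax A w" unfolding rmax_def
  proof
    fix s assume "s \<in> A"
    from s[OF this] have "s \<in> S" "len (w \<otimes> s) \<le> len w"
      using assms(3) generate_mult[OF assms(1,2)] by blast+
    then show "len (w \<otimes> s) < len w" using len_mult_generator_right[of s w] w by auto
  qed
qed

text \<open>If \<open>w\<close> and \<open>w'\<close> both have maximal length, then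
  \<open>w \<star> w'\<close> equals \<open>w'\<close>, which absorbs on its left, and also
  \<open>w\<close>, which absorbs on its right.\<close>

lemma longest_unique:
  assumes "finitary G S A"
  shows "\<exists>!w. w \<in> generate G A \<and> (\<forall>v\<in>generate G A. len v \<le> len w)"
proof -
  have A: "A \<subseteq> S" "finite (generate G A)" using assms by (auto simp: finitary_def)
  have "generate G A \<noteq> {}" using generate.one by blast
  then have "\<exists>w. w \<in> generate G A \<and> (\<forall>v\<in>generate G A. len v \<le> len w)"
    using Max_in[of "len ` generate G A"] Max_ge[of "len ` generate G A"] A(2) by fastforce
  moreover have "w = w'"
    if "w \<in> generate G A" "\<forall>v\<in>generate G A. len v \<le> len w"
      "w' \<in> generate G A" "\<forall>v\<in>generate G A. len v \<le> len w'" for w w'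
  proof -
    have c: "w \<in> carrier G" "w' \<in> carrier G"
      using that(1,3) generate_subset_carrier[OF A(1)] by auto
    have "w \<star> w' = w'"
      by (rule lmax_absorb[OF A(1) max_len_lmax_rmax(1)[OF A(1) that(3,4)] c(2) that(1)])
    moreover have "w \<star> w' = w"
      by (rule rmax_absorb[OF A(1) max_len_lmax_rmax(2)[OF A(1) that(1,2)] c(1) that(3)])
    ultimately show ?thesis by simp
  qed
  ultimately show ?thesis by blast
qed

context
  fixes A assumes fin: "finitary G S A"
begin

lemma finitary_subset: "A \<subseteq> S"
  using fin by (simp add: finitary_def)

lemma longest_in_generate: "longest G S A \<in> generate G A"
  and longest_ge: "v \<in> generate G A \<Longrightarrow> len v \<le> len (longest G S A)"
  using theI'[OF longest_unique[OF fin]] unfolding longest_def by blast+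

lemma longest_closed [simp]: "longest G S A \<in> carrier G"
  using longest_in_generate generate_subset_carrier finitary_subset by blast

lemma lmax_longest: "lmax A (longest G S A)" and rmax_longest: "rmax A (longest G S A)"
  using max_len_lmax_rmax[OF finitary_subset longest_in_generate] longest_ge by blast+

lemma longest_inv [simp]: "inv (longest G S A) = longest G S A"
proof -
  have "inv (longest G S A) \<in> generate G A"
    "\<forall>v\<in>generate G A. len v \<le> len (inv (longest G S A))"
    using generate_inv[OF finitary_subset longest_in_generate] longest_ge by simp_all
  then show ?thesis using longest_unique[OF fin] longest_in_generate longest_ge by blast
qed

end

text \<open>Here \<open>a\<close> is a shortest element of the coset \<open>x W_A\<close>.
  Additivity is proved by appending the letters of a reduced word over \<open>A\<close> one by one:
  a drop in length would lead, by exchange, to a shorter element of the coset or to a shortening of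
  the reduced word.\<close>

lemma min_coset_decomposition:
  assumes "A \<subseteq> S" "x \<in> carrier G"
  obtains a u where "a \<in> carrier G" "u \<in> generate G A" "x = a \<otimes> u"
    "\<And>v. v \<in> generate G A \<Longrightarrow> len (a \<otimes> v) = len a + len v"
proof -
  let ?P = "\<lambda>a. \<exists>u\<in>generate G A. a = x \<otimes> u"
  have "?P x" using generate.one[of G A] assms by (intro bexI[of _ \<one>]) auto
  then obtain a where "?P a" and min: "\<And>b. ?P b \<Longrightarrow> len a \<le> len b"
    using ex_has_least_nat[of ?P x len] by blast
  then obtain u where u: "u \<in> generate G A" "a = x \<otimes> u" by blast
  have uc: "u \<in> carrier G" using u generate_subset_carrier assms by blast
  then have a: "a \<in> carrier G" and x: "x = a \<otimes> inv u" using u assms by (simp_all add: m_assoc)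
  have amin: "len a \<le> len (a \<otimes> v)" if "v \<in> generate G A" for v
  proof (rule min, intro bexI)
    show "a \<otimes> v = x \<otimes> (u \<otimes> v)"
      using u uc assms that generate_subset_carrier[OF assms(1)] by (simp add: m_assoc subset_iff)
  qed (use generate_mult assms u that in blast)
  obtain as where as: "as \<in> lists S" "word as = a" "length as = len a"
    using reduced_word[OF a] by blast
  have "len (a \<otimes> word vs) = len a + length vs"
    if "vs \<in> lists A" "length vs = len (word vs)" for vs
    using that
  proof (induction vs rule: rev_induct)
    case (snoc s vs)
    have s: "s \<in> A" "s \<in> S" and vs: "vs \<in> lists S" "vs \<in> lists A"
      using snoc.prems assms(1) lists_subset by auto
    have l: "len (word vs \<otimes> s) = Suc (length vs)"
      using snoc.prems s vs by (simp add: word_append)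
    then have "length vs = len (word vs)"
      using len_mult_generator_right[OF s(2) word_closed[OF vs(1)]] len_word_le[OF vs(1)] by auto
    then have IH: "len (a \<otimes> word vs) = len a + length vs" using snoc.IH vs by simp
    have "\<not> len (a \<otimes> word vs \<otimes> s) < len (a \<otimes> word vs)"
    proof
      assume less: "len (a \<otimes> word vs \<otimes> s) < len (a \<otimes> word vs)"
      have av: "as @ vs \<in> lists S" "word (as @ vs) = a \<otimes> word vs"
        using as vs by (simp_all add: word_append)
      obtain us b ws where del: "as @ vs = us @ b # ws"
        "a \<otimes> word vs \<otimes> s = word (us @ ws)"
        using strong_exchange[OF generator_reflection[OF s(2)] av(1)] less unfolding av(2) by metis
      \<comment> \<open>The deleted letter \<open>b\<close> lies either in the word of
        \<open>a\<close> or in the word \<open>vs\<close>.\<close>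
      consider ws' where "as = us @ b # ws'" "ws = ws' @ vs" | us' where "us = as @ us'" "vs = us' @ b # ws"
        using del(1) by (auto simp: append_eq_append_conv2 append_eq_Cons_conv Cons_eq_append_conv)
      then show False
      proof cases
        case 1
        let ?a' = "word (us @ ws')"
        have in_S: "us @ ws' \<in> lists S" using 1 as by simp
        have a': "?a' \<in> carrier G" using in_S by blast
        have wv: "word vs \<in> generate G A" using vs generate_eq_words[OF assms(1)] by blast
        have eq: "a \<otimes> word vs \<otimes> s = ?a' \<otimes> word vs"
          using del 1 in_S vs word_append[of "us @ ws'" vs] by simp
        \<comment> \<open>Deleting a letter of \<open>as\<close> multiplies \<open>a\<close> by a
          conjugate of \<open>s\<close> lying in \<open>W_A\<close>, so the shorter element stays in
          the coset and contradicts minimality of \<open>a\<close>.\<close>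
        have "a \<otimes> (word vs \<otimes> s \<otimes> inv (word vs)) = a \<otimes> word vs \<otimes> s \<otimes> inv (word vs)"
          using a vs s by (simp add: m_assoc)
        also have "\<dots> = ?a'" using eq a' vs by (simp add: m_assoc)
        finally have "len a \<le> len ?a'"
          using amin[of "word vs \<otimes> s \<otimes> inv (word vs)"] wv s
          by (simp add: generate_mult generate_inv generate.incl assms(1))
        then show False using len_word_le[OF in_S] 1 as by simp
      next
        case 2
        have in_S: "us' @ ws \<in> lists S" using 2 vs by simp
        have "a \<otimes> (word vs \<otimes> s) = a \<otimes> word (us' @ ws)"
          using del 2 as vs a s in_S word_append[of as "us' @ ws"] by (simp add: m_assoc)
        then have "word vs \<otimes> s = word (us' @ ws)" using a vs s in_S by simp
        then show False using l len_word_le[OF in_S] 2 by simp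
      qed
    qed
    then have "len (a \<otimes> word vs \<otimes> s) = Suc (len (a \<otimes> word vs))"
      using len_mult_generator_right[of s "a \<otimes> word vs"] s a vs by auto
    then show ?case using IH a s vs by (simp add: word_append m_assoc)
  qed (use a in simp)
  then have "len (a \<otimes> v) = len a + len v" if "v \<in> generate G A" for v
    using reduced_word_generate[OF assms(1) that] by metis
  then show ?thesis using that[OF a generate_inv[OF assms(1) u(1)] x] by blast
qed

text \<open>Writing \<open>x = a u\<close> with \<open>a\<close> minimal in its coset, absorption on
  both sides gives \<open>x = x \<star> w_A = a \<star> u \<star> w_A = a \<star> w_A\<close>, and
  the last product is an ordinary one by additivity of lengths.\<close>

lemma rmax_decomposition:
  assumes "finitary G S A" "x \<in> carrier G" "rmax A x"
  obtains a where "a \<in> carrier G" "x = a \<otimes> longest G S A" "len x = len a + len (longest G S A)"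
proof -
  let ?w = "longest G S A"
  note A = finitary_subset[OF assms(1)] and w = longest_in_generate[OF assms(1)]
  have wc: "?w \<in> carrier G" using assms by simp
  obtain a u where *: "a \<in> carrier G" "u \<in> generate G A" "x = a \<otimes> u"
    and add: "\<And>v. v \<in> generate G A \<Longrightarrow> len (a \<otimes> v) = len a + len v"
    using min_coset_decomposition[OF A assms(2)] by blast
  have uc: "u \<in> carrier G" using * generate_subset_carrier[OF A] by blast
  have xa: "x = a \<star> u" using * uc add by (simp add: star_eq_mult)
  have "x = x \<star> ?w" using rmax_absorb[OF A assms(3,2) w] by simp
  also have "\<dots> = a \<star> u \<star> ?w" by (simp flip: xa)
  also have "a \<star> u \<star> ?w = a \<star> ?w"
    using * uc wc lmax_absorb[OF A lmax_longest[OF assms(1)] wc *(2)] by (simp add: star_assoc)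
  also have "\<dots> = a \<otimes> ?w" using * wc w add by (simp add: star_eq_mult)
  finally have "x = a \<otimes> ?w" .
  then show ?thesis using that[OF *(1)] add[OF w] by metis
qed

lemma lmax_decomposition:
  assumes "finitary G S A" "x \<in> carrier G" "lmax A x"
  obtains b where "b \<in> carrier G" "x = longest G S A \<otimes> b" "len x = len (longest G S A) + len b"
proof -
  note A = finitary_subset[OF assms(1)]
  have "rmax A (inv x)"
    unfolding rmax_def
  proof
    fix s assume "s \<in> A"
    then show "len (inv x \<otimes> s) < len (inv x)"
      using assms(2,3) subsetD[OF A] by (simp add: lmax_def flip: len_inv_mult)
  qed
  then obtain a where a: "a \<in> carrier G" "inv x = a \<otimes> longest G S A"
    "len (inv x) = len a + len (longest G S A)"
    using rmax_decomposition[OF assms(1)] assms(2) by (metis inv_closed)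
  have "x = inv (a \<otimes> longest G S A)" using a(2) assms(2) by (metis inv_inv)
  then have "x = longest G S A \<otimes> inv a" using a(1) assms(1) by (simp add: inv_mult_group)
  moreover have "len x = len (longest G S A) + len (inv a)"
    using a(1,3) assms(2) by simp
  ultimately show ?thesis using that[of "inv a"] a(1) by blast
qed

subsection \<open>Double cosets\<close>

abbreviation double_coset :: "'a set \<Rightarrow> 'a set \<Rightarrow> 'a \<Rightarrow> 'a set" where
  "double_coset I J w \<equiv> (generate G I #> w) <#> generate G J"

lemma mem_double_coset:
  "y \<in> double_coset I J w \<longleftrightarrow> (\<exists>u\<in>generate G I. \<exists>v\<in>generate G J. y = u \<otimes> w \<otimes> v)"
  by (auto simp: set_mult_def r_coset_def)

lemma dcosets_iff: "p \<in> dcosets G I J \<longleftrightarrow> (\<exists>w\<in>carrier G. p = (double_coset I J w, I, J))"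
  by (auto simp: dcosets_def)

lemma len_mult_inv:
  assumes "s \<in> S" "x \<in> carrier G" shows "len (x \<otimes> s) = len (s \<otimes> inv x)"
  using len_inv_mult[of s "inv x"] assms by simp

lemma bruhat_inv_iff:
  assumes "x \<in> carrier G" "y \<in> carrier G" shows "inv x \<preceq> inv y \<longleftrightarrow> x \<preceq> y"
  using bruhat_inv[of x y] bruhat_inv[of "inv x" "inv y"] assms by auto

text \<open>The chain is \<open>s x \<preceq> up s x \<preceq> up s z = z\<close>.\<close>

lemma bruhat_descent:
  assumes "s \<in> S" "x \<preceq> z" "x \<in> carrier G" "len (s \<otimes> z) < len z" shows "s \<otimes> x \<preceq> z"
  using bruhat_trans[OF bruhat_mult_up[OF assms(1,3)] up_mono[OF assms(2,1,3)]] assms(4)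
  by (simp add: up_def)

text \<open>Dually, \<open>z = down s z \<preceq> down s x \<preceq> s x\<close>.\<close>

lemma bruhat_ascent:
  assumes "s \<in> S" "z \<preceq> x" "z \<in> carrier G" "len z < len (s \<otimes> z)" shows "z \<preceq> s \<otimes> x"
  using bruhat_trans[OF down_mono[OF assms(2,1,3)] bruhat_down_mult[OF assms(1)]]
    bruhat_closed[OF assms(2,3)] assms(4)
  by (simp add: down_def)

lemma bruhat_descent_right:
  assumes "s \<in> S" "x \<preceq> z" "x \<in> carrier G" "len (z \<otimes> s) < len z" shows "x \<otimes> s \<preceq> z"
proof -
  have z: "z \<in> carrier G" using bruhat_closed assms by blast
  have "s \<otimes> inv x \<preceq> inv z"
    using assms z by (intro bruhat_descent) (simp_all add: bruhat_inv len_mult_inv)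
  then show ?thesis using bruhat_inv_iff[of "x \<otimes> s" z] assms z by (simp add: inv_mult_group)
qed

lemma bruhat_ascent_right:
  assumes "s \<in> S" "z \<preceq> x" "z \<in> carrier G" "len z < len (z \<otimes> s)" shows "z \<preceq> x \<otimes> s"
proof -
  have x: "x \<in> carrier G" using bruhat_closed assms by blast
  have "inv z \<preceq> s \<otimes> inv x"
    using assms x by (intro bruhat_ascent) (simp_all add: bruhat_inv len_mult_inv)
  then show ?thesis using bruhat_inv_iff[of z "x \<otimes> s"] assms x by (simp add: inv_mult_group)
qed

text \<open>Reduces Bruhat bounds on a whole double coset to one generator step at a time.\<close>

lemma double_coset_induct [consumes 4, case_names base left right]:
  assumes "y \<in> double_coset I J x" "x \<in> carrier G" "I \<subseteq> S" "J \<subseteq> S" "P x"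
    and left: "\<And>s z. s \<in> I \<Longrightarrow> z \<in> carrier G \<Longrightarrow> P z \<Longrightarrow> P (s \<otimes> z)"
    and right: "\<And>s z. s \<in> J \<Longrightarrow> z \<in> carrier G \<Longrightarrow> P z \<Longrightarrow> P (z \<otimes> s)"
  shows "P y"
proof -
  obtain us vs where *: "us \<in> lists I" "vs \<in> lists J" "y = word us \<otimes> x \<otimes> word vs"
  proof -
    obtain u v where "u \<in> generate G I" "v \<in> generate G J" "y = u \<otimes> x \<otimes> v"
      using assms(1) mem_double_coset by blast
    with that show thesis
      unfolding generate_eq_words[OF assms(3)] generate_eq_words[OF assms(4)] by (elim imageE) simp
  qed
  have us: "us \<in> lists S" and vs: "vs \<in> lists S"
    using * lists_subset assms(3,4) by blast+
  have "P (x \<otimes> word vs)" using *(2)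
  proof (induction vs rule: rev_induct)
    case (snoc s vs)
    then have "s \<in> J" "s \<in> S" "vs \<in> lists S" "vs \<in> lists J" using assms(4) lists_subset by auto
    then show ?case
      using right[of s "x \<otimes> word vs"] snoc.IH assms(2) by (simp add: word_append m_assoc)
  qed (use assms in simp)
  then have "P (word us \<otimes> (x \<otimes> word vs))" using *(1)
  proof (induction us)
    case (Cons s us)
    then have "s \<in> S" "us \<in> lists S" using assms(3) lists_subset by auto
    then show ?case
      using left[of s "word us \<otimes> (x \<otimes> word vs)"] Cons assms(2) vs by (simp add: m_assoc)
  qed (use assms vs in simp)
  then show ?thesis using *(3) us vs assms(2) by (simp add: m_assoc)
qed

text \<open>Lying below \<open>z\<close> survives every generator step by the descent rules. For
  \<open>x = z\<close> this shows that an element maximal on both sides is the Bruhat maximum of its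
  double coset.\<close>

lemma bruhat_double_coset_max:
  assumes "y \<in> double_coset I J x" "x \<in> carrier G" "I \<subseteq> S" "J \<subseteq> S" "x \<preceq> z" "lmax I z" "rmax J z"
  shows "y \<preceq> z"
  using assms(1-5)
proof (induction rule: double_coset_induct)
  case (left s y)
  then show ?case using assms(3,6) bruhat_descent unfolding lmax_def by blast
next
  case (right s y)
  then show ?case using assms(4,7) bruhat_descent_right unfolding rmax_def by blast
qed

lemma bruhat_double_coset_min:
  assumes "y \<in> double_coset I J x" "x \<in> carrier G" "I \<subseteq> S" "J \<subseteq> S" "z \<preceq> x" "z \<in> carrier G"
    "\<forall>s\<in>I. len z < len (s \<otimes> z)" "\<forall>s\<in>J. len z < len (z \<otimes> s)"
  shows "z \<preceq> y"
  using assms(1-5)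
proof (induction rule: double_coset_induct)
  case (left s y)
  then show ?case using assms(3,6,7) bruhat_ascent by blast
next
  case (right s y)
  then show ?case using assms(4,6,8) bruhat_ascent_right by blast
qed

section \<open>Maximal and minimal elements of double cosets of finite parabolic subgroups\<close>

context
  fixes I J assumes IJ: "finitary G S I" "finitary G S J"
begin

lemma IJ_subset: "I \<subseteq> S" "J \<subseteq> S"
  using IJ finitary_subset by blast+

lemma self_in_double_coset: "x \<in> carrier G \<Longrightarrow> x \<in> double_coset I J x"
  unfolding mem_double_coset
  by (intro bexI[of _ \<one>] generate.one) simp

lemma double_coset_subset_carrier: "x \<in> carrier G \<Longrightarrow> double_coset I J x \<subseteq> carrier G"
  using generate_subset_carrier IJ_subset unfolding mem_double_coset subset_iff by fastforce

lemma double_coset_left: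
  assumes "y \<in> double_coset I J x" "u \<in> generate G I" "x \<in> carrier G"
  shows "u \<otimes> y \<in> double_coset I J x"
proof -
  obtain a b where ab: "a \<in> generate G I" "b \<in> generate G J" "y = a \<otimes> x \<otimes> b"
    using assms(1) mem_double_coset by blast
  moreover have "u \<in> carrier G" "a \<in> carrier G" "b \<in> carrier G"
    using ab assms(2) generate_subset_carrier IJ_subset by blast+
  ultimately have "u \<otimes> y = u \<otimes> a \<otimes> x \<otimes> b" using assms(3) by (simp add: m_assoc)
  moreover have "u \<otimes> a \<in> generate G I" using generate_mult[OF IJ_subset(1) assms(2) ab(1)] .
  ultimately show ?thesis unfolding mem_double_coset using ab(2) by blast
qed

lemma double_coset_right:
  assumes "y \<in> double_coset I J x" "v \<in> generate G J" "x \<in> carrier G"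
  shows "y \<otimes> v \<in> double_coset I J x"
proof -
  obtain a b where ab: "a \<in> generate G I" "b \<in> generate G J" "y = a \<otimes> x \<otimes> b"
    using assms(1) mem_double_coset by blast
  moreover have "v \<in> carrier G" "a \<in> carrier G" "b \<in> carrier G"
    using ab assms(2) generate_subset_carrier IJ_subset by blast+
  ultimately have "y \<otimes> v = a \<otimes> x \<otimes> (b \<otimes> v)" using assms(3) by (simp add: m_assoc)
  moreover have "b \<otimes> v \<in> generate G J" using generate_mult[OF IJ_subset(2) ab(2) assms(2)] .
  ultimately show ?thesis unfolding mem_double_coset using ab(1) by blast
qed

lemma double_coset_eq:
  assumes "y \<in> double_coset I J x" "x \<in> carrier G" shows "double_coset I J y = double_coset I J x"
proof -
  note c = generate_subset_carrier[OF IJ_subset(1)] generate_subset_carrier[OF IJ_subset(2)]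
  have sub: "double_coset I J y \<subseteq> double_coset I J x"
    if "y \<in> double_coset I J x" "x \<in> carrier G" for x y
  proof
    fix z assume "z \<in> double_coset I J y"
    then obtain u v where "u \<in> generate G I" "v \<in> generate G J" "z = u \<otimes> y \<otimes> v"
      using mem_double_coset by blast
    then show "z \<in> double_coset I J x" using double_coset_left double_coset_right that by simp
  qed
  obtain u v where uv: "u \<in> generate G I" "v \<in> generate G J" "y = u \<otimes> x \<otimes> v"
    using assms mem_double_coset by blast
  have "x = inv u \<otimes> y \<otimes> inv v" using uv assms(2) c by (simp add: m_assoc subset_iff)
  then have "x \<in> double_coset I J y"
    unfolding mem_double_coset using uv generate_inv IJ_subset by blast
  moreover have "y \<in> carrier G" using assms double_coset_subset_carrier by blast
  ultimately show ?thesis using sub assms by blast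
qed

lemma dcosets_eqI:
  assumes "p \<in> dcosets G I J" "x \<in> fst p" shows "p = (double_coset I J x, I, J)" "x \<in> carrier G"
proof -
  obtain w where "w \<in> carrier G" "p = (double_coset I J w, I, J)"
    using assms(1) dcosets_iff by blast
  then show "p = (double_coset I J x, I, J)" "x \<in> carrier G"
    using double_coset_eq[of x w] double_coset_subset_carrier assms(2) by auto
qed

lemma dcoset_mult_generator:
  assumes "p \<in> dcosets G I J" "z \<in> fst p"
  shows "s \<in> I \<Longrightarrow> s \<otimes> z \<in> fst p" "s \<in> J \<Longrightarrow> z \<otimes> s \<in> fst p"
proof -
  obtain w where w: "w \<in> carrier G" "fst p = double_coset I J w"
    using assms(1) dcosets_iff by auto
  then show "s \<in> I \<Longrightarrow> s \<otimes> z \<in> fst p" "s \<in> J \<Longrightarrow> z \<otimes> s \<in> fst p"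
    using double_coset_left[OF _ generate.incl w(1)] double_coset_right[OF _ generate.incl w(1)]
      assms(2) by simp_all
qed

lemma finite_double_coset: "finite (double_coset I J x)"
proof -
  have "double_coset I J x = (\<lambda>(u, v). u \<otimes> x \<otimes> v) ` (generate G I \<times> generate G J)"
    by (auto simp: mem_double_coset) blast
  then show ?thesis using IJ by (simp add: finitary_def)
qed

text \<open>A longest element exists because the double coset is finite, and no generator step
  inside the coset can lengthen it.\<close>

lemma ex_maximal:
  assumes "p \<in> dcosets G I J" shows "\<exists>z\<in>fst p. lmax I z \<and> rmax J z"
proof -
  obtain w where w: "w \<in> carrier G" "p = (double_coset I J w, I, J)"
    using assms(1) dcosets_iff by blast
  have "finite (fst p)" "fst p \<noteq> {}" using w finite_double_coset self_in_double_coset by auto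
  then obtain z where z: "z \<in> fst p" "\<And>y. y \<in> fst p \<Longrightarrow> len y \<le> len z"
    using Max_in[of "len ` fst p"] Max_ge[of "len ` fst p"] by fastforce
  have zc: "z \<in> carrier G" using dcosets_eqI assms z by blast
  have "lmax I z" unfolding lmax_def
  proof
    fix s assume s: "s \<in> I"
    then have "len (s \<otimes> z) \<le> len z" "s \<in> S"
      using z(2) dcoset_mult_generator[OF assms z(1)] IJ_subset by blast+
    then show "len (s \<otimes> z) < len z" using len_mult_generator[of s z] zc by auto
  qed
  moreover have "rmax J z" unfolding rmax_def
  proof
    fix s assume s: "s \<in> J"
    then have "len (z \<otimes> s) \<le> len z" "s \<in> S"
      using z(2) dcoset_mult_generator[OF assms z(1)] IJ_subset by blast+
    then show "len (z \<otimes> s) < len z" using len_mult_generator_right[of s z] zc by auto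
  qed
  ultimately show ?thesis using z by blast
qed

lemma ex_minimal:
  assumes "p \<in> dcosets G I J"
  shows "\<exists>z\<in>fst p. (\<forall>s\<in>I. len z < len (s \<otimes> z)) \<and> (\<forall>s\<in>J. len z < len (z \<otimes> s))"
proof -
  obtain w where w: "w \<in> carrier G" "p = (double_coset I J w, I, J)"
    using assms(1) dcosets_iff by blast
  then have "w \<in> fst p" using self_in_double_coset by simp
  then obtain z where z: "z \<in> fst p" "\<And>y. y \<in> fst p \<Longrightarrow> len z \<le> len y"
    using ex_has_least_nat[of "\<lambda>z. z \<in> fst p" w len] by blast
  have zc: "z \<in> carrier G" using dcosets_eqI assms z by blast
  have "len z < len (s \<otimes> z)" if s: "s \<in> I" for s
  proof -
    have "len z \<le> len (s \<otimes> z)" "s \<in> S"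
      using s z(2) dcoset_mult_generator[OF assms z(1)] IJ_subset by blast+
    then show ?thesis using len_mult_generator[of s z] zc by auto
  qed
  moreover have "len z < len (z \<otimes> s)" if s: "s \<in> J" for s
  proof -
    have "len z \<le> len (z \<otimes> s)" "s \<in> S"
      using s z(2) dcoset_mult_generator[OF assms z(1)] IJ_subset by blast+
    then show ?thesis using len_mult_generator_right[of s z] zc by auto
  qed
  ultimately show ?thesis using z by blast
qed

lemma max_elt_eqI:
  assumes "p \<in> dcosets G I J" "z \<in> fst p" "lmax I z" "rmax J z"
  shows "max_elt G S p = z"
  unfolding max_elt_def
proof (rule the_equality)
  have "fst p = double_coset I J z" "z \<in> carrier G"
    using dcosets_eqI[OF assms(1,2)] by (simp, blast)
  then show *: "z \<in> fst p \<and> (\<forall>y\<in>fst p. y \<preceq> z)"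
    using bruhat_double_coset_max[of _ I z J z] IJ_subset assms by auto
  show "x = z" if "x \<in> fst p \<and> (\<forall>y\<in>fst p. y \<preceq> x)" for x
    using that * bruhat_antisym by blast
qed

lemma min_elt_eqI:
  assumes "p \<in> dcosets G I J" "z \<in> fst p"
    "\<forall>s\<in>I. len z < len (s \<otimes> z)" "\<forall>s\<in>J. len z < len (z \<otimes> s)"
  shows "min_elt G S p = z"
  unfolding min_elt_def
proof (rule the_equality)
  have "fst p = double_coset I J z" "z \<in> carrier G"
    using dcosets_eqI[OF assms(1,2)] by (simp, blast)
  then show *: "z \<in> fst p \<and> (\<forall>y\<in>fst p. z \<preceq> y)"
    using bruhat_double_coset_min[of _ I z J z] IJ_subset assms by auto
  show "x = z" if "x \<in> fst p \<and> (\<forall>y\<in>fst p. x \<preceq> y)" for x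
    using that * bruhat_antisym by blast
qed

lemma
  assumes "p \<in> dcosets G I J"
  shows max_elt_in: "max_elt G S p \<in> fst p"
    and max_elt_closed: "max_elt G S p \<in> carrier G"
    and lmax_max_elt: "lmax I (max_elt G S p)"
    and rmax_max_elt: "rmax J (max_elt G S p)"
    and dcoset_eq_max_elt: "p = (double_coset I J (max_elt G S p), I, J)"
proof -
  obtain z where "z \<in> fst p" "lmax I z" "rmax J z" using ex_maximal[OF assms] by blast
  then show *: "max_elt G S p \<in> fst p" and "lmax I (max_elt G S p)" "rmax J (max_elt G S p)"
    using max_elt_eqI[OF assms] by simp_all
  show "max_elt G S p \<in> carrier G" "p = (double_coset I J (max_elt G S p), I, J)"
    using dcosets_eqI[OF assms *] by blast+
qed

lemma
  assumes "p \<in> dcosets G I J"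
  shows min_elt_in: "min_elt G S p \<in> fst p"
    and min_elt_closed: "min_elt G S p \<in> carrier G"
    and min_elt_left: "\<forall>s\<in>I. len (min_elt G S p) < len (s \<otimes> min_elt G S p)"
    and min_elt_right: "\<forall>s\<in>J. len (min_elt G S p) < len (min_elt G S p \<otimes> s)"
    and dcoset_eq_min_elt: "p = (double_coset I J (min_elt G S p), I, J)"
proof -
  obtain z where "z \<in> fst p" "\<forall>s\<in>I. len z < len (s \<otimes> z)" "\<forall>s\<in>J. len z < len (z \<otimes> s)"
    using ex_minimal[OF assms] by blast
  then show *: "min_elt G S p \<in> fst p"
    and "\<forall>s\<in>I. len (min_elt G S p) < len (s \<otimes> min_elt G S p)"
      "\<forall>s\<in>J. len (min_elt G S p) < len (min_elt G S p \<otimes> s)"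
    using min_elt_eqI[OF assms] by simp_all
  show "min_elt G S p \<in> carrier G" "p = (double_coset I J (min_elt G S p), I, J)"
    using dcosets_eqI[OF assms *] by blast+
qed

text \<open>The order is defined by minimal elements, while the star product is governed by maximal
  ones. Either comparison gives \<open>min p \<preceq> max q\<close>. Moving within \<open>p\<close>
  below \<open>max q\<close> reaches \<open>max p\<close>; moving within \<open>q\<close> above
  \<open>min p\<close> reaches \<open>min q\<close>.\<close>

lemma dcoset_le_iff_max_elt:
  assumes p: "p \<in> dcosets G I J" and q: "q \<in> dcosets G I J"
  shows "dcoset_le G S p q \<longleftrightarrow> max_elt G S p \<preceq> max_elt G S q"
proof
  have mm: "min_elt G S r \<preceq> max_elt G S r" if r: "r \<in> dcosets G I J" for r
  proof -
    have "max_elt G S r \<in> double_coset I J (min_elt G S r)"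
      using max_elt_in[OF r] dcoset_eq_min_elt[OF r] by (metis fst_conv)
    then show ?thesis
      using bruhat_double_coset_min[OF _ min_elt_closed[OF r] IJ_subset bruhat_refl min_elt_closed[OF r]
          min_elt_left[OF r] min_elt_right[OF r]] by blast
  qed
  {
    assume "dcoset_le G S p q"
    then have "min_elt G S p \<preceq> max_elt G S q"
      using mm[OF q] bruhat_trans unfolding dcoset_le_def by blast
    moreover have "max_elt G S p \<in> double_coset I J (min_elt G S p)"
      using max_elt_in[OF p] dcoset_eq_min_elt[OF p] by (metis fst_conv)
    ultimately show "max_elt G S p \<preceq> max_elt G S q"
      using bruhat_double_coset_max min_elt_closed[OF p] IJ_subset lmax_max_elt[OF q] rmax_max_elt[OF q]
      by blast
  }
  {
    assume "max_elt G S p \<preceq> max_elt G S q"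
    then have "min_elt G S p \<preceq> max_elt G S q"
      using mm[OF p] bruhat_trans by blast
    moreover have "min_elt G S q \<in> double_coset I J (max_elt G S q)"
      using min_elt_in[OF q] dcoset_eq_max_elt[OF q] by (metis fst_conv)
    ultimately show "dcoset_le G S p q" unfolding dcoset_le_def
      using bruhat_double_coset_min[OF _ max_elt_closed[OF q] IJ_subset _ min_elt_closed[OF p]
          min_elt_left[OF p] min_elt_right[OF p]] by blast
  }
qed

end

section \<open>The star product of double cosets\<close>

lemma
  assumes fin: "finitary G S I" "finitary G S J" "finitary G S K"
    and p: "p \<in> dcosets G I J" and q: "q \<in> dcosets G J K"
  shows dcoset_star_in: "dcoset_star G S p q \<in> dcosets G I K"
    and max_elt_dcoset_star: "max_elt G S (dcoset_star G S p q) = max_elt G S p \<star> max_elt G S q"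
proof -
  note sub = finitary_subset[OF fin(1)] finitary_subset[OF fin(2)] finitary_subset[OF fin(3)]
  define z where "z = max_elt G S p \<star> max_elt G S q"
  have c: "max_elt G S p \<in> carrier G" "max_elt G S q \<in> carrier G"
    using max_elt_closed fin p q by blast+
  then have z: "z \<in> carrier G" by (simp add: z_def)
  \<comment> \<open>Left maximality is inherited from the left factor and right maximality from the
    right factor.\<close>
  have "lmax I z" "rmax K z" unfolding z_def
    using lmax_star[OF sub(1)] rmax_star[OF sub(3)] lmax_max_elt[OF fin(1,2) p]
      rmax_max_elt[OF fin(2,3) q] c by blast+
  moreover define r where "r = (double_coset I K z, I, K)"
  moreover have "r \<in> dcosets G I K" using z dcosets_iff r_def by blast
  moreover have "z \<in> fst r" using self_in_double_coset[OF fin(1,3) z] r_def by simp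
  ultimately have max_r: "max_elt G S r = z" and r: "r \<in> dcosets G I K"
    using max_elt_eqI[OF fin(1,3)] by blast+
  \<comment> \<open>A double coset is determined by its maximal element, so the description in
    \<open>dcoset_star\<close> has a single solution.\<close>
  have uniq: "x = r" if "x \<in> dcosets G I K" "max_elt G S x = z" for x
    using dcoset_eq_max_elt[OF fin(1,3) that(1)] unfolding that(2) r_def .
  have "fst (snd p) = I" "snd (snd q) = K" using p q by (auto simp: dcosets_def)
  then have "dcoset_star G S p q = (THE x. x \<in> dcosets G I K \<and> max_elt G S x = z)"
    by (simp add: dcoset_star_def z_def)
  also have "\<dots> = r" using r max_r uniq by blast
  finally have "dcoset_star G S p q = r" .
  then show "dcoset_star G S p q \<in> dcosets G I K"
    "max_elt G S (dcoset_star G S p q) = max_elt G S p \<star> max_elt G S q"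
    using r max_r by (simp_all add: z_def)
qed

end

subsection \<open>Expressions\<close>

text \<open>The flag says whether the step into the first term counts as increasing (for \<open>maxima\<close>),
  or as decreasing (for \<open>minima\<close>).\<close>

fun maxima :: "bool \<Rightarrow> 'a set list \<Rightarrow> 'a set list" where
  "maxima b [] = []"
| "maxima b [A] = (if b then [A] else [])"
| "maxima b (A # B # Is) = (if b \<and> B \<subset> A then [A] else []) @ maxima (A \<subset> B) (B # Is)"

fun minima :: "bool \<Rightarrow> 'a set list \<Rightarrow> 'a set list" where
  "minima b [] = []"
| "minima b [A] = []"
| "minima b (A # B # Is) = (if b \<and> A \<subset> B then [A] else []) @ minima (B \<subset> A) (B # Is)"

lemma upt_0_Suc: "[0..<Suc n] = 0 # map Suc [0..<n]"
  by (simp add: map_Suc_upt upt_conv_Cons del: upt_Suc)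

text \<open>Links the recursion, which suits induction, to the indexed comprehension that defines
  \<open>local_maxima\<close>.\<close>

lemma maxima_eq_concat:
  "maxima b Is = concat (map (\<lambda>k. if (if k = 0 then b else Is ! (k - 1) \<subset> Is ! k) \<and>
      (Suc k = length Is \<or> Is ! Suc k \<subset> Is ! k) then [Is ! k] else []) [0..<length Is])"
proof (induction b Is rule: maxima.induct)
  case (3 b A B Is)
  have upt: "[0..<length (A # B # Is)] = 0 # map Suc [0..<length (B # Is)]"
    unfolding length_Cons by (rule upt_0_Suc)
  show ?case
    unfolding upt maxima.simps 3 list.map map_map concat.simps
    by (intro arg_cong2[where f = append] arg_cong[where f = concat] map_cong)
      (auto split: nat.split simp: nth_Cons simp del: upt_Suc)
qed simp_all

lemma minima_eq_concat:
  "minima b Is = concat (map (\<lambda>k. if (if k = 0 then b else Is ! k \<subset> Is ! (k - 1)) \<and>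
      Is ! k \<subset> Is ! Suc k then [Is ! k] else []) [0..<length Is - 1])"
proof (induction b Is rule: minima.induct)
  case (3 b A B Is)
  have upt: "[0..<length (A # B # Is) - 1] = 0 # map Suc [0..<length (B # Is) - 1]"
    by (simp only: length_Cons diff_Suc_1 upt_0_Suc)
  show ?case
    unfolding upt minima.simps 3 list.map map_map concat.simps
    by (intro arg_cong2[where f = append] arg_cong[where f = concat] map_cong)
      (auto split: nat.split simp: nth_Cons simp del: upt_Suc)
qed simp_all

text \<open>The flag is \<open>True\<close> because the first term counts as a maximum as soon as
  its successor is smaller.\<close>

lemma local_maxima_eq: "local_maxima Is = maxima True Is"
  unfolding local_maxima_def maxima_eq_concat
  by (intro arg_cong[where f = concat] map_cong) auto

text \<open>The flag is \<open>False\<close> because the first term never counts as an interior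
  minimum.\<close>

lemma local_minima_eq: "local_minima Is = minima False Is"
proof (cases "length Is - 1")
  case (Suc n)
  then have "[0..<length Is - 1] = 0 # [1..<length Is - 1]" by (simp add: upt_conv_Cons)
  then show ?thesis unfolding local_minima_def minima_eq_concat
    by (auto intro!: arg_cong[where f = concat] map_cong)
qed (simp add: local_minima_def minima_eq_concat)

text \<open>For the lengths \<open>h\<close> of the longest elements this is the telescoped form of
  \<open>\<Sum> h(K\<^sub>i) - \<Sum> h(L\<^sub>i)\<close>. Truncated subtraction makes the increasing steps contribute 0.\<close>

fun descent_length :: "('a set \<Rightarrow> nat) \<Rightarrow> 'a set list \<Rightarrow> nat" where
  "descent_length h [] = 0"
| "descent_length h [A] = h A"
| "descent_length h (A # B # Is) = (h A - h B) + descent_length h (B # Is)"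

text \<open>The closing summand \<open>h (last P)\<close> is lost when further steps follow, which
  accounts for the correction \<open>h (hd Q)\<close>.\<close>

lemma descent_length_append:
  assumes "P \<noteq> []" "Q \<noteq> []" "last P = hd Q"
  shows "descent_length h (P @ tl Q) + h (hd Q) = descent_length h P + descent_length h Q"
  using assms
proof (induction h P rule: descent_length.induct)
  case (2 h A)
  then show ?case by (cases Q) auto
qed simp_all

text \<open>In the application \<open>f K L\<close> is the length of \<open>w_K w_L^-1\<close>,
  which is at least \<open>h K - h L\<close>. Summing over consecutive maxima and minima telescopes
  to the descent length.\<close>

lemma descent_length_le_factors:
  fixes h :: "'a set \<Rightarrow> nat" and f :: "'a set \<Rightarrow> 'a set \<Rightarrow> nat"
  defines "V \<equiv> \<lambda>Ks Ls. (\<Sum>(K, L)\<leftarrow>zip Ks Ls. f K L) + h (last Ks)"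
  assumes f: "\<And>K L. K \<in> Q \<Longrightarrow> L \<in> Q \<Longrightarrow> h K \<le> f K L + h L"
    and mono: "\<And>K L. K \<in> Q \<Longrightarrow> L \<in> Q \<Longrightarrow> L \<subseteq> K \<Longrightarrow> h L \<le> h K"
    and Is: "Is \<noteq> []" "set Is \<subseteq> Q" "successively (\<lambda>A B. A \<subset> B \<or> B \<subset> A) Is"
  shows "descent_length h Is \<le> V (local_maxima Is) (local_minima Is)"
proof -
  \<comment> \<open>The two conjuncts are the two states of the scan. In the second, the first term
    is reached by descending from a pending maximum \<open>K\<close>; the descent
    \<open>h K - h (hd Is)\<close> is split over both sides to avoid truncated subtraction.\<close>
  have "(maxima True Is \<noteq> [] \<and> descent_length h Is \<le> V (maxima True Is) (minima False Is)) \<and>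
    (\<forall>K\<in>Q. descent_length h Is + h K \<le> V (K # maxima False Is) (minima True Is) + h (hd Is))"
    using Is
  proof (induction Is rule: induct_list012)
    case (3 A B Is)
    have IH: "maxima True (B # Is) \<noteq> []"
      "descent_length h (B # Is) \<le> V (maxima True (B # Is)) (minima False (B # Is))"
      "\<And>K. K \<in> Q \<Longrightarrow>
        descent_length h (B # Is) + h K \<le> V (K # maxima False (B # Is)) (minima True (B # Is)) + h B"
      using 3 by auto
    have Q: "A \<in> Q" "B \<in> Q" using 3 by auto
    from 3 consider "A \<subset> B" "\<not> B \<subset> A" | "B \<subset> A" "\<not> A \<subset> B" by auto
    then show ?case
    proof cases
      case 1
      have eq: "maxima b (A # B # Is) = maxima True (B # Is)"
        "minima b (A # B # Is) = (if b then [A] else []) @ minima False (B # Is)" for b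
        using 1 by simp_all
      have len: "descent_length h (A # B # Is) = descent_length h (B # Is)"
        using mono[OF Q(2,1) psubset_imp_subset[OF 1(1)]] by simp
      \<comment> \<open>When the scan turns upwards at \<open>A\<close>, the pair
        \<open>(K, A)\<close> is complete and contributes the factor \<open>f K A\<close>.\<close>
      have V: "V (K # maxima True (B # Is)) (A # minima False (B # Is)) =
          f K A + V (maxima True (B # Is)) (minima False (B # Is))" for K
        using IH(1) by (simp add: V_def)
      have "descent_length h (B # Is) + h K \<le>
          V (K # maxima True (B # Is)) (A # minima False (B # Is)) + h A" if "K \<in> Q" for K
        unfolding V using IH(2) f[OF that Q(1)] by simp
      then show ?thesis unfolding eq len using IH(1,2) by simp
    next
      case 2
      have eq: "maxima b (A # B # Is) = (if b then [A] else []) @ maxima False (B # Is)"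
        "minima b (A # B # Is) = minima True (B # Is)" for b
        using 2 by simp_all
      have len: "descent_length h (A # B # Is) + h B = descent_length h (B # Is) + h A"
        using mono[OF Q psubset_imp_subset[OF 2(1)]] by simp
      have "descent_length h (A # B # Is) + h K \<le>
          V (K # maxima False (B # Is)) (minima True (B # Is)) + h A" if "K \<in> Q" for K
        using len IH(3)[OF that] by linarith
      moreover from this[OF Q(1)]
      have "descent_length h (A # B # Is) \<le> V (A # maxima False (B # Is)) (minima True (B # Is))"
        by linarith
      ultimately show ?thesis unfolding eq by simp
    qed
  qed (auto simp: V_def)
  then show ?thesis by (simp add: local_maxima_eq local_minima_eq)
qed

section \<open>Lengths of expressions and of the elements they express\<close>

context coxeter begin

lemma len_longest_mono:
  assumes "finitary G S K" "finitary G S L" "L \<subseteq> K"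
  shows "len (longest G S L) \<le> len (longest G S K)"
  using longest_ge[OF assms(1)] longest_in_generate[OF assms(2)] mono_generate[OF assms(3)] by blast

lemma expression_chain:
  assumes "is_expression G S Is"
  shows "Is \<noteq> []" "set Is \<subseteq> Collect (finitary G S)" "successively (\<lambda>A B. A \<subset> B \<or> B \<subset> A) Is"
proof -
  show "successively (\<lambda>A B. A \<subset> B \<or> B \<subset> A) Is"
    using assms unfolding is_expression_def by (elim conjE successively_mono) auto
qed (use assms in \<open>auto simp: is_expression_def\<close>)

abbreviation expression_length :: "'a set list \<Rightarrow> nat" where
  "expression_length \<equiv> descent_length (\<lambda>A. len (longest G S A))"

abbreviation expression_star :: "'a set list \<Rightarrow> 'a" where
  "expression_star Is \<equiv> foldr (\<star>) (map (longest G S) Is) \<one>"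

text \<open>Subadditivity of length applied to \<open>w_K = (w_K w_L^-1) w_L\<close> bounds each
  factor from below.\<close>

lemma expression_length_le_factors:
  assumes "is_expression G S Is"
  shows "expression_length Is \<le> sum_list (map len (factors G S Is))"
proof -
  let ?f = "\<lambda>K L. len (longest G S K \<otimes> inv (longest G S L))"
  have "sum_list (map len (factors G S Is)) =
      (\<Sum>(K, L)\<leftarrow>zip (local_maxima Is) (local_minima Is). ?f K L) + len (longest G S (last (local_maxima Is)))"
    by (simp add: factors_def comp_def case_prod_unfold)
  moreover have "len (longest G S K) \<le> ?f K L + len (longest G S L)"
    if "finitary G S K" "finitary G S L" for K L
    using len_mult_le[of "longest G S K \<otimes> inv (longest G S L)" "longest G S L"] that
    by (simp add: m_assoc del: longest_inv)
  ultimately show ?thesis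
    using descent_length_le_factors[OF _ _ expression_chain[OF assms], of "\<lambda>A. len (longest G S A)" ?f]
      len_longest_mono by simp
qed

text \<open>An increasing step from \<open>A\<close> to \<open>B\<close> costs nothing, because
  \<open>w_A\<close> is absorbed by the product that follows; left maximality is carried along for
  this purpose. At a decreasing step \<open>w_A = a w_B\<close>, the part \<open>w_B\<close> is
  absorbed and only \<open>a\<close>, of length \<open>len w_A - len w_B\<close>, is added.\<close>

lemma expression_star_bound:
  assumes "Is \<noteq> []" "set Is \<subseteq> Collect (finitary G S)" "successively (\<lambda>A B. A \<subset> B \<or> B \<subset> A) Is"
  shows "expression_star Is \<in> carrier G \<and> lmax (hd Is) (expression_star Is) \<and>
    len (expression_star Is) \<le> expression_length Is"
  using assms
proof (induction Is rule: induct_list012)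
  case (2 A)
  then show ?case by (simp add: lmax_longest)
next
  case (3 A B Is)
  let ?F = "expression_star (B # Is)"
  have fin: "finitary G S A" "finitary G S B" using 3 by auto
  note sub = finitary_subset[OF fin(1)] finitary_subset[OF fin(2)]
  have F: "?F \<in> carrier G" "lmax B ?F" "len ?F \<le> expression_length (B # Is)"
    using 3 by auto
  have wc: "longest G S A \<in> carrier G" using fin by simp
  have lm: "lmax A (longest G S A \<star> ?F)"
    by (rule lmax_star[OF sub(1) lmax_longest[OF fin(1)] wc F(1)])
  have "len (longest G S A \<star> ?F) \<le> expression_length (A # B # Is)"
  proof (cases "A \<subset> B")
    case True
    then have "longest G S A \<in> generate G B"
      using longest_in_generate[OF fin(1)] mono_generate[of A B] by auto
    then have "longest G S A \<star> ?F = ?F" using lmax_absorb[OF sub(2) F(2,1)] by blast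
    then show ?thesis using F(3) by simp
  next
    case False
    then have "B \<subseteq> A" using 3 by auto
    then have "rmax B (longest G S A)" using rmax_longest[OF fin(1)] by (auto simp: rmax_def)
    then obtain a where a: "a \<in> carrier G" "longest G S A = a \<otimes> longest G S B"
      "len (longest G S A) = len a + len (longest G S B)"
      using rmax_decomposition[OF fin(2) wc] by blast
    have "longest G S A = a \<star> longest G S B"
      using a star_eq_mult[of a "longest G S B"] fin by simp
    then have "longest G S A \<star> ?F = a \<star> (longest G S B \<star> ?F)"
      using a(1) F(1) fin by (simp add: star_assoc)
    also have "longest G S B \<star> ?F = ?F"
      using lmax_absorb[OF sub(2) F(2,1)] longest_in_generate[OF fin(2)] by blast
    finally show ?thesis using len_star_le[OF a(1) F(1)] F(3) a(3) by simp
  qed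
  then show ?case using lm F(1) wc by simp
qed simp

lemma expresses_len:
  assumes "expresses G S Is p" shows "len (max_elt G S p) \<le> expression_length Is"
  using assms expression_star_bound[OF expression_chain] unfolding expresses_def by metis

lemma foldr_star_closed: "set xs \<subseteq> carrier G \<Longrightarrow> foldr (\<star>) xs \<one> \<in> carrier G"
  by (induction xs) auto

lemma foldr_star_append:
  assumes "set xs \<subseteq> carrier G" "set ys \<subseteq> carrier G"
  shows "foldr (\<star>) (xs @ ys) \<one> = foldr (\<star>) xs \<one> \<star> foldr (\<star>) ys \<one>"
  using assms by (induction xs) (auto simp: star_assoc foldr_star_closed)

text \<open>The common term \<open>I\<close> occurs once in the concatenation and twice in the
  product of the two stars; this makes no difference since \<open>w_I\<close> is idempotent.\<close>

lemma expression_star_concat: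
  assumes "set P \<subseteq> Collect (finitary G S)" "set Q \<subseteq> Collect (finitary G S)" "P \<noteq> []" "Q \<noteq> []"
    "last P = hd Q"
  shows "expression_star (expr_concat P Q) = expression_star P \<star> expression_star Q"
proof -
  obtain P' I where P: "P = P' @ [I]" using assms(3) by (metis append_butlast_last_id)
  then obtain Q' where Q: "Q = I # Q'" using assms(4,5) by (cases Q) auto
  have c: "set (map (longest G S) Is) \<subseteq> carrier G" if "set Is \<subseteq> Collect (finitary G S)" for Is
    using that by auto
  have fin: "finitary G S I" using assms(2) Q by simp
  then have I: "longest G S I \<in> carrier G" "longest G S I \<star> longest G S I = longest G S I"
    using lmax_absorb[OF finitary_subset lmax_longest] longest_in_generate by simp_all
  have cs: "expression_star P' \<in> carrier G" "expression_star Q' \<in> carrier G"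
    using assms(1,2) P Q by (auto intro!: foldr_star_closed c)
  have "expression_star (expr_concat P Q) = expression_star P' \<star> (longest G S I \<star> expression_star Q')"
    using foldr_star_append[OF c c, of P' "I # Q'"] assms(1,2) P Q by (simp add: expr_concat_def)
  also have "\<dots> = (expression_star P' \<star> longest G S I) \<star> (longest G S I \<star> expression_star Q')"
    using I cs by (simp add: star_assoc flip: star_assoc[of "longest G S I" "longest G S I"])
  also have "expression_star P' \<star> longest G S I = expression_star P"
    using foldr_star_append[OF c c, of P' "[I]"] assms(1) P fin I by simp
  finally show ?thesis using Q by simp
qed

end

lemma expr_concat_ends:
  assumes "P \<noteq> []" "Q \<noteq> []" "last P = hd Q"
  shows "expr_concat P Q \<noteq> []" "hd (expr_concat P Q) = hd P" "last (expr_concat P Q) = last Q"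
  using assms by (cases Q; simp add: expr_concat_def)+

theorem theorem2p20:
  fixes G :: "('a, 'b) monoid_scheme" and S I J K L :: "'a set"
    and p q q' r pqr :: "'a dcoset"
  assumes "coxeter_system G S"
    and "finitary G S I" and "finitary G S J" and "finitary G S K" and "finitary G S L"
    and "q \<in> dcosets G I J" and "q' \<in> dcosets G I J"
    and "dcoset_less G S q' q"
    and "p \<in> dcosets G K I" and "r \<in> dcosets G J L"
    and "reduced_composition3 G S p q r pqr"
  shows "dcoset_less G S (dcoset_star G S (dcoset_star G S p q') r) pqr"
proof -
  interpret coxeter G S
    using assms(1) by (simp add: coxeter_def coxeter_axioms_def coxeter_system_def)
  note I = assms(2) and J = assms(3) and K = assms(4) and L = assms(5)
    and q = assms(6) and q' = assms(7) and p = assms(9) and r = assms(10)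
  define mp mq mq' mr where m_defs: "mp = max_elt G S p" "mq = max_elt G S q"
    "mq' = max_elt G S q'" "mr = max_elt G S r"
  have c: "mp \<in> carrier G" "mq \<in> carrier G" "mq' \<in> carrier G" "mr \<in> carrier G"
    unfolding m_defs using max_elt_closed I J K L p q q' r by blast+
  have wc: "longest G S I \<in> carrier G" "longest G S J \<in> carrier G" using I J by simp_all

  obtain P Q R where red: "reduced_expression G S P p" "reduced_expression G S Q q"
      "reduced_expression G S R r" "reduced_expression G S (expr_concat (expr_concat P Q) R) pqr"
    and ends: "last P = hd Q" "last Q = hd R"
    using assms(11) unfolding reduced_composition3_def by blast
  let ?X = "expr_concat (expr_concat P Q) R"
  have ex: "expresses G S P p" "expresses G S Q q" "expresses G S R r" "expresses G S ?X pqr"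
    using red unfolding reduced_expression_def by blast+
  then have isx: "is_expression G S P" "is_expression G S Q" "is_expression G S R" "is_expression G S ?X"
    and star_eq: "mp = expression_star P" "mq = expression_star Q" "mr = expression_star R"
      "max_elt G S pqr = expression_star ?X"
    unfolding expresses_def m_defs by blast+
  note ch = expression_chain[OF isx(1)] expression_chain[OF isx(2)] expression_chain[OF isx(3)]
  have hd_last: "hd P = K" "hd Q = I" "hd R = J" "last R = L"
    using ex p q r unfolding expresses_def by (auto simp: dcosets_def)
  note PQ = expr_concat_ends[OF ch(1,4) ends(1)]
  then have PQ_R: "last (expr_concat P Q) = hd R" using ends by simp
  have ne: "expr_concat P Q \<noteq> []" "last (expr_concat P Q) = hd R" "hd ?X = K" "last ?X = L"
    using PQ PQ_R expr_concat_ends[OF PQ(1) ch(7) PQ_R] hd_last by simp_all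
  have fin_PQ: "set (expr_concat P Q) \<subseteq> Collect (finitary G S)"
    using ch(2,5) list.set_sel(2)[OF ch(4)] unfolding expr_concat_def by auto
  have pqr: "pqr \<in> dcosets G K L" using ex(4) ne(3,4) unfolding expresses_def by simp
  have max_pqr: "max_elt G S pqr = mp \<star> mq \<star> mr"
    unfolding star_eq using ch ends ne fin_PQ by (simp add: expression_star_concat)

  define y where "y = dcoset_star G S (dcoset_star G S p q') r"
  have y: "y \<in> dcosets G K L" and max_y: "max_elt G S y = mp \<star> mq' \<star> mr"
    using dcoset_star_in[OF K I J p q'] max_elt_dcoset_star[OF K I J p q']
      dcoset_star_in[OF K J L _ r] max_elt_dcoset_star[OF K J L _ r]
    by (simp_all add: y_def m_defs)

  \<comment> \<open>The comparison passes to maximal elements, and these are distinct because they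
    determine their cosets.\<close>
  have "mq' \<preceq> mq" "mq' \<noteq> mq"
    using assms(8) dcoset_le_iff_max_elt[OF I J q' q] dcoset_eq_max_elt[OF I J q]
      dcoset_eq_max_elt[OF I J q'] by (auto simp: dcoset_less_def m_defs)
  then have len_q: "len mq' < len mq" and le: "mp \<star> mq' \<star> mr \<preceq> mp \<star> mq \<star> mr"
    using bruhat_len star_mono c by auto

  \<comment> \<open>Splitting \<open>w_I\<close> off \<open>mp\<close> and \<open>w_J\<close> off
    \<open>mr\<close> isolates the parts that \<open>mq'\<close> absorbs.\<close>
  obtain a where a: "a \<in> carrier G" "mp = a \<otimes>\<^bsub>G\<^esub> longest G S I" "len mp = len a + len (longest G S I)"
    using rmax_decomposition[OF I c(1)] rmax_max_elt[OF K I p] m_defs by blast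
  obtain b where b: "b \<in> carrier G" "mr = longest G S J \<otimes>\<^bsub>G\<^esub> b" "len mr = len (longest G S J) + len b"
    using lmax_decomposition[OF J c(4)] lmax_max_elt[OF J L r] m_defs by blast
  have mp: "mp = a \<star> longest G S I" and mr: "mr = longest G S J \<star> b"
    using a b wc star_eq_mult by simp_all
  have left: "longest G S I \<star> mq' = mq'"
    using lmax_absorb[OF finitary_subset[OF I] _ c(3) longest_in_generate[OF I]]
      lmax_max_elt[OF I J q'] m_defs by blast
  have right: "mq' \<star> longest G S J = mq'"
    using rmax_absorb[OF finitary_subset[OF J] _ c(3) longest_in_generate[OF J]]
      rmax_max_elt[OF I J q'] m_defs by blast
  have "mp \<star> mq' = a \<star> mq'"
    unfolding mp using star_assoc[OF a(1) wc(1) c(3)] left by simp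
  then have "mp \<star> mq' \<star> mr = a \<star> mq' \<star> longest G S J \<star> b"
    unfolding mr using star_assoc[OF _ wc(2) b(1)] a(1) c(3) by simp
  also have "a \<star> mq' \<star> longest G S J = a \<star> mq'"
    using star_assoc[OF a(1) c(3) wc(2)] right by simp
  finally have "mp \<star> mq' \<star> mr = a \<star> mq' \<star> b" .
  then have "len (mp \<star> mq' \<star> mr) \<le> len a + len mq' + len b"
    using len_star_le[of "a \<star> mq'" b] len_star_le[of a mq'] a(1) b(1) c(3) by simp
  also have "len a + len mq' + len b < len a + len mq + len b" using len_q by simp
  also have "\<dots> \<le> expression_length ?X"
  proof -
    \<comment> \<open>Each of the two junctions costs the length of \<open>w_I\<close> or
      \<open>w_J\<close>, exactly what \<open>a\<close> and \<open>b\<close> lack compared with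
      \<open>mp\<close> and \<open>mr\<close>.\<close>
    have "expression_length ?X + len (longest G S J) = expression_length (expr_concat P Q) + expression_length R"
      "expression_length (expr_concat P Q) + len (longest G S I) = expression_length P + expression_length Q"
      using descent_length_append[OF PQ(1) ch(7) PQ_R] descent_length_append[OF ch(1,4) ends(1)]
      unfolding expr_concat_def hd_last by simp_all
    then show ?thesis
      using expresses_len[OF ex(1)] expresses_len[OF ex(2)] expresses_len[OF ex(3)] a(3) b(3)
      by (simp add: m_defs)
  qed
  also have "\<dots> \<le> len (max_elt G S pqr)"
  proof -
    \<comment> \<open>Reducedness of the composite expression enters here: the length of its maximal
      element is the full sum of the factor lengths.\<close>
    have "len (max_elt G S pqr) = sum_list (map len (factors G S ?X))"
      using red(4) unfolding reduced_expression_def by blast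
    then show ?thesis using expression_length_le_factors[OF isx(4)] by (simp only:)
  qed
  finally have "y \<noteq> pqr" using max_y by auto
  moreover have "dcoset_le G S y pqr"
    using dcoset_le_iff_max_elt[OF K L y pqr] le max_y max_pqr by simp
  ultimately show ?thesis by (simp add: dcoset_less_def y_def)
qed

end
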